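(* Let $n\ge 3$, let $A_1,\dots,A_n$ be algebras and, for every $i<j$, let $R_{ij}:A_j\otimes A_i\to A_i\otimes A_j$ be a unital twisting map, such that for all $i<j<k$ the maps $R_{ij}$, $R_{jk}$, $R_{ik}$ are compatible. For $2\le j\le n$ write $D_j:=A_{j-1}\otimes_{R_{j-1\,j}}A_j$, and define $$T^i_{j-1,j}:D_j\otimes A_i\to A_i\otimes D_j,\qquad T^i_{j-1,j}:=(R_{i\,j-1}\otimes A_j)\circ(A_{j-1}\otimes R_{i\,j})\qquad (i<j-1),$$ $$T^i_{j-1,j}:A_i\otimes D_j\to D_j\otimes A_i,\qquad T^i_{j-1,j}:=(A_{j-1}\otimes R_{j\,i})\circ(R_{j-1\,i}\otimes A_j)\qquad (i>j).$$ Then all the maps $T^i_{j-1,j}$ are twisting maps, and for all $i<k$ with $i,k\notin\{j-1,j\}$ the maps $R_{ik}$, $T^i_{j-1,j}$ and $T^k_{j-1,j}$ are compatible (with the three algebras $A_i$, $A_k$, $D_j$ arranged in the order in which they occur in the list $A_1,\dots,A_{j-2},D_j,A_{j+1},\dots,A_n$). Moreover, for $i=2,\dots,n$ the (inductively defined) algebras $$A_1\otimes_{R_{12}}\cdots\otimes_{R_{i-3\,i-2}}A_{i-2}\otimes_{T^{i-2}_{i-1,i}}(A_{i-1}\otimes_{R_{i-1\,i}}A_i)\otimes_{T^{i+1}_{i-1,i}}A_{i+1}\otimes_{R_{i+1\,i+2}}\cdots\otimes_{R_{n-1\,n}}A_n$$ are all equal (i.e. they have the same multiplication on $A_1\otimes\cdots\otimes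 A_n$).
   Context: Fix a field or commutative ring $k$; $\otimes=\otimes_k$; algebras are associative unital $k$-algebras and $\mu_A$ is the product of $A$. An object also denotes its identity map. A twisting map for algebras $A,B$ is a $k$-linear map $R:B\otimes A\to A\otimes B$ with $$R\circ(B\otimes\mu_A)=(\mu_A\otimes B)\circ(A\otimes R)\circ(R\otimes A),\qquad R\circ(\mu_B\otimes A)=(A\otimes\mu_B)\circ(R\otimes B)\circ(B\otimes R).$$ Then $A\otimes_R B$ denotes $A\otimes B$ with the associative product $\mu_R:=(\mu_A\otimes\mu_B)\circ(A\otimes R\otimes B)$. $R$ is unital if $R(1\otimes a)=a\otimes 1$ and $R(b\otimes 1)=1\otimes b$ for all $a,b$. For an ordered triple of algebras $(X,Y,Z)$, twisting maps $R_{XY}:Y\otimes X\to X\otimes Y$, $R_{YZ}:Z\otimes Y\to Y\otimes Z$, $R_{XZ}:Z\otimes X\to X\otimes Z$ are called compatible if $$(X\otimes R_{YZ})\circ(R_{XZ}\otimes Y)\circ(Z\otimes R_{XY})=(R_{XY}\otimes Z)\circ(Y\otimes R_{XZ})\circ(R_{YZ}\otimes X).$$ Inductive definition of iterated products: for a list of two algebras with a twisting map the product is $A_1\otimes_{R_{12}}A_2$. For a list of $n\ge3$ algebras with pairwise twisting maps, every ordered triple being compatible, the displayed algebra with index $i$ is the iterated product of the list of $n-1$ algebras $A_1,\dots,A_{i-2},(A_{i-1}\otimes_{R_{i-1\,i}}A_i),A_{i+1},\dots,A_n$ with respect to the twisting maps $R_{pq}$ ($p,q\notin\{i-1,i\}$)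 and $T^p_{i-1,i}$ ($p\notin\{i-1,i\}$); the iterated product of $n-1$ algebras is well defined (independent of the grouping) by the case $n-1$ of the theorem. The underlying space is always identified with $A_1\otimes\cdots\otimes A_n$. *)

theory Defs
  imports "HOL-Algebra.Module"
begin

section \<open>Associative unital algebras\<close>

text \<open>The library locale \<open>algebra\<close> is restricted to commutative algebras.\<close>

definition assoc_algebra :: "('k, 'm) ring_scheme \<Rightarrow> ('k, 'a) module \<Rightarrow> bool" where
  "assoc_algebra K A \<longleftrightarrow> module K A \<and> ring A \<and>
     (\<forall>c\<in>carrier K. \<forall>x\<in>carrier A. \<forall>y\<in>carrier A.
        (c \<odot>\<^bsub>A\<^esub> x) \<otimes>\<^bsub>A\<^esub> y = c \<odot>\<^bsub>A\<^esub> (x \<otimes>\<^bsub>A\<^esub> y) \<and>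
        x \<otimes>\<^bsub>A\<^esub> (c \<odot>\<^bsub>A\<^esub> y) = c \<odot>\<^bsub>A\<^esub> (x \<otimes>\<^bsub>A\<^esub> y))"

section \<open>Tensor products of finite lists of modules\<close>

text \<open>
  \<open>tensor K [M\<^sub>1, \<dots>, M\<^sub>m]\<close> is the module \<open>M\<^sub>1 \<otimes> \<dots> \<otimes> M\<^sub>m\<close> over \<open>K\<close>: finite formal sums
  of terms \<open>c (x\<^sub>1, \<dots>, x\<^sub>m)\<close>, encoded as lists of pairs, modulo the least congruence that
  makes them a module in which \<open>(x\<^sub>1, \<dots>, x\<^sub>m)\<close> is multilinear.  Since the factors are kept in one
  flat list, \<open>(U \<otimes> V) \<otimes> W\<close> and \<open>U \<otimes> (V \<otimes> W)\<close> are literally the same module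
  \<open>tensor K (U @ V @ W)\<close>; this is the usual identification of iterated tensor products.
\<close>

definition words :: "('k, 'a) module list \<Rightarrow> 'a list set" where
  "words Ms = {w. list_all2 (\<lambda>x M. x \<in> carrier M) w Ms}"

type_synonym ('k, 'a) formal_sum = "('k \<times> 'a list) list"

definition formal_sums ::
    "('k, 'm) ring_scheme \<Rightarrow> ('k, 'a) module list \<Rightarrow> ('k, 'a) formal_sum set" where
  "formal_sums K Ms = lists (carrier K \<times> words Ms)"

inductive tensor_eq ::
    "('k, 'm) ring_scheme \<Rightarrow> ('k, 'a) module list \<Rightarrow>
     ('k, 'a) formal_sum \<Rightarrow> ('k, 'a) formal_sum \<Rightarrow> bool"
  for K Ms where
  refl: "s \<in> formal_sums K Ms \<Longrightarrow> tensor_eq K Ms s s"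
| sym: "tensor_eq K Ms s t \<Longrightarrow> tensor_eq K Ms t s"
| trans: "tensor_eq K Ms s t \<Longrightarrow> tensor_eq K Ms t u \<Longrightarrow> tensor_eq K Ms s u"
| append: "tensor_eq K Ms s s' \<Longrightarrow> tensor_eq K Ms t t' \<Longrightarrow> tensor_eq K Ms (s @ t) (s' @ t')"
| commute: "s \<in> formal_sums K Ms \<Longrightarrow> t \<in> formal_sums K Ms \<Longrightarrow> tensor_eq K Ms (s @ t) (t @ s)"
| zero: "w \<in> words Ms \<Longrightarrow> tensor_eq K Ms [(\<zero>\<^bsub>K\<^esub>, w)] []"
| add: "c \<in> carrier K \<Longrightarrow> d \<in> carrier K \<Longrightarrow> w \<in> words Ms \<Longrightarrow>
    tensor_eq K Ms [(c \<oplus>\<^bsub>K\<^esub> d, w)] [(c, w), (d, w)]"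
| add_entry: "c \<in> carrier K \<Longrightarrow> w \<in> words Ms \<Longrightarrow> i < length Ms \<Longrightarrow>
    x \<in> carrier (Ms ! i) \<Longrightarrow> y \<in> carrier (Ms ! i) \<Longrightarrow>
    tensor_eq K Ms [(c, w[i := x \<oplus>\<^bsub>Ms ! i\<^esub> y])] [(c, w[i := x]), (c, w[i := y])]"
| smult_entry: "c \<in> carrier K \<Longrightarrow> r \<in> carrier K \<Longrightarrow> w \<in> words Ms \<Longrightarrow> i < length Ms \<Longrightarrow>
    x \<in> carrier (Ms ! i) \<Longrightarrow>
    tensor_eq K Ms [(c, w[i := r \<odot>\<^bsub>Ms ! i\<^esub> x])] [(c \<otimes>\<^bsub>K\<^esub> r, w[i := x])]"

definition tensor_class ::
    "('k, 'm) ring_scheme \<Rightarrow> ('k, 'a) module list \<Rightarrow> ('k, 'a) formal_sum \<Rightarrow> ('k, 'a) formal_sum set"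
  where "tensor_class K Ms s = {t. tensor_eq K Ms s t}"

text \<open>Only the module structure matters; the ring multiplication fields are left unspecified.\<close>

definition tensor ::
    "('k, 'm) ring_scheme \<Rightarrow> ('k, 'a) module list \<Rightarrow> ('k, ('k, 'a) formal_sum set) module" where
  "tensor K Ms =
    \<lparr> carrier = tensor_class K Ms ` formal_sums K Ms,
      mult = undefined,
      one = undefined,
      zero = tensor_class K Ms [],
      add = (\<lambda>X Y. \<Union>s\<in>X. \<Union>t\<in>Y. tensor_class K Ms (s @ t)),
      smult = (\<lambda>c X. \<Union>s\<in>X. tensor_class K Ms (map (\<lambda>(d, w). (c \<otimes>\<^bsub>K\<^esub> d, w)) s)) \<rparr>"

definition pure_tensor ::
    "('k, 'm) ring_scheme \<Rightarrow> ('k, 'a) module list \<Rightarrow> 'a list \<Rightarrow> ('k, 'a) formal_sum set" where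
  "pure_tensor K Ms w = tensor_class K Ms [(\<one>\<^bsub>K\<^esub>, w)]"

text \<open>The bilinear map \<open>(X, Y) \<mapsto> X \<otimes> Y\<close> from \<open>tensor K Ms \<times> tensor K Ns\<close> to
  \<open>tensor K (Ms @ Ns)\<close>.\<close>

definition tensor_elem ::
    "('k, 'm) ring_scheme \<Rightarrow> ('k, 'a) module list \<Rightarrow> ('k, 'a) module list \<Rightarrow>
     ('k, 'a) formal_sum set \<Rightarrow> ('k, 'a) formal_sum set \<Rightarrow> ('k, 'a) formal_sum set" where
  "tensor_elem K Ms Ns X Y =
    (\<Union>s\<in>X. \<Union>t\<in>Y. tensor_class K (Ms @ Ns) [(c \<otimes>\<^bsub>K\<^esub> d, v @ w). (c, v) \<leftarrow> s, (d, w) \<leftarrow> t])"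

section \<open>Linear maps between tensor products\<close>

text \<open>A map carries its source and target; \<open>fn\<close> is extensional, so that equality of maps
  is equality of records.\<close>

record ('k, 'a) tmap =
  src :: "('k, 'a) module list"
  tgt :: "('k, 'a) module list"
  fn :: "('k, 'a) formal_sum set \<Rightarrow> ('k, 'a) formal_sum set"

definition linear_maps ::
    "('k, 'm) ring_scheme \<Rightarrow> ('k, 'a) module list \<Rightarrow> ('k, 'a) module list \<Rightarrow> ('k, 'a) tmap set" where
  "linear_maps K U V = {f. src f = U \<and> tgt f = V \<and>
     fn f \<in> carrier (tensor K U) \<rightarrow>\<^sub>E carrier (tensor K V) \<and>
     (\<forall>x\<in>carrier (tensor K U). \<forall>y\<in>carrier (tensor K U).
        fn f (x \<oplus>\<^bsub>tensor K U\<^esub> y) = fn f x \<oplus>\<^bsub>tensor K V\<^esub> fn f y) \<and>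
     (\<forall>c\<in>carrier K. \<forall>x\<in>carrier (tensor K U).
        fn f (c \<odot>\<^bsub>tensor K U\<^esub> x) = c \<odot>\<^bsub>tensor K V\<^esub> fn f x)}"

text \<open>The linear map on a tensor product with prescribed values on pure tensors; it exists
  uniquely when the prescribed values depend multilinearly on the entries.\<close>

definition linear_extension ::
    "('k, 'm) ring_scheme \<Rightarrow> ('k, 'a) module list \<Rightarrow> ('k, 'a) module list \<Rightarrow>
     ('a list \<Rightarrow> ('k, 'a) formal_sum set) \<Rightarrow> ('k, 'a) tmap" where
  "linear_extension K U V \<phi> =
    (THE f. f \<in> linear_maps K U V \<and> (\<forall>w\<in>words U. fn f (pure_tensor K U w) = \<phi> w))"

definition tensor_map ::
    "('k, 'a) tmap \<Rightarrow> ('k, 'm) ring_scheme \<Rightarrow> ('k, 'a) tmap \<Rightarrow> ('k, 'a) tmap"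
    ("(_ \<boxtimes>\<^bsub>_\<^esub> _)" [76, 0, 75] 75) where
  "f \<boxtimes>\<^bsub>K\<^esub> g = linear_extension K (src f @ src g) (tgt f @ tgt g)
     (\<lambda>w. tensor_elem K (tgt f) (tgt g)
            (fn f (pure_tensor K (src f) (take (length (src f)) w)))
            (fn g (pure_tensor K (src g) (drop (length (src f)) w))))"

definition comp_map ::
    "('k, 'a) tmap \<Rightarrow> ('k, 'm) ring_scheme \<Rightarrow> ('k, 'a) tmap \<Rightarrow> ('k, 'a) tmap"
    ("(_ \<bullet>\<^bsub>_\<^esub> _)" [71, 0, 70] 70) where
  "g \<bullet>\<^bsub>K\<^esub> f = \<lparr> src = src f, tgt = tgt g, fn = compose (carrier (tensor K (src f))) (fn g) (fn f) \<rparr>"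

definition id_map :: "('k, 'm) ring_scheme \<Rightarrow> ('k, 'a) module list \<Rightarrow> ('k, 'a) tmap" where
  "id_map K U = \<lparr> src = U, tgt = U, fn = (\<lambda>x\<in>carrier (tensor K U). x) \<rparr>"

section \<open>Algebras supported on tensor products\<close>

text \<open>An algebra with underlying module \<open>tensor K (space A)\<close> and product
  \<open>mu A : A \<otimes> A \<rightarrow> A\<close>.\<close>

record ('k, 'a) talgebra =
  space :: "('k, 'a) module list"
  mu :: "('k, 'a) tmap"
  unit :: "('k, 'a) formal_sum set"

abbreviation ident :: "('k, 'm) ring_scheme \<Rightarrow> ('k, 'a) talgebra \<Rightarrow> ('k, 'a) tmap" where
  "ident K A \<equiv> id_map K (space A)"

definition is_talgebra :: "('k, 'm) ring_scheme \<Rightarrow> ('k, 'a) talgebra \<Rightarrow> bool" where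
  "is_talgebra K A \<longleftrightarrow>
     mu A \<in> linear_maps K (space A @ space A) (space A) \<and>
     unit A \<in> carrier (tensor K (space A)) \<and>
     mu A \<bullet>\<^bsub>K\<^esub> (mu A \<boxtimes>\<^bsub>K\<^esub> ident K A) = mu A \<bullet>\<^bsub>K\<^esub> (ident K A \<boxtimes>\<^bsub>K\<^esub> mu A) \<and>
     (\<forall>x\<in>carrier (tensor K (space A)).
        fn (mu A) (tensor_elem K (space A) (space A) (unit A) x) = x \<and>
        fn (mu A) (tensor_elem K (space A) (space A) x (unit A)) = x)"

text \<open>An ordinary algebra, viewed on the one-fold tensor product.\<close>

definition talg :: "('k, 'm) ring_scheme \<Rightarrow> ('k, 'a) module \<Rightarrow> ('k, 'a) talgebra" where
  "talg K A =
    \<lparr> space = [A],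
      mu = linear_extension K [A, A] [A] (\<lambda>w. pure_tensor K [A] [w ! 0 \<otimes>\<^bsub>A\<^esub> w ! 1]),
      unit = pure_tensor K [A] [\<one>\<^bsub>A\<^esub>] \<rparr>"

section \<open>Twisting maps\<close>

definition twisting_map ::
    "('k, 'm) ring_scheme \<Rightarrow> ('k, 'a) talgebra \<Rightarrow> ('k, 'a) talgebra \<Rightarrow> ('k, 'a) tmap \<Rightarrow> bool" where
  "twisting_map K A B R \<longleftrightarrow>
     R \<in> linear_maps K (space B @ space A) (space A @ space B) \<and>
     R \<bullet>\<^bsub>K\<^esub> (ident K B \<boxtimes>\<^bsub>K\<^esub> mu A) =
       (mu A \<boxtimes>\<^bsub>K\<^esub> ident K B) \<bullet>\<^bsub>K\<^esub> (ident K A \<boxtimes>\<^bsub>K\<^esub> R) \<bullet>\<^bsub>K\<^esub> (R \<boxtimes>\<^bsub>K\<^esub> ident K A) \<and>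
     R \<bullet>\<^bsub>K\<^esub> (mu B \<boxtimes>\<^bsub>K\<^esub> ident K A) =
       (ident K A \<boxtimes>\<^bsub>K\<^esub> mu B) \<bullet>\<^bsub>K\<^esub> (R \<boxtimes>\<^bsub>K\<^esub> ident K B) \<bullet>\<^bsub>K\<^esub> (ident K B \<boxtimes>\<^bsub>K\<^esub> R)"

definition unital_twisting_map ::
    "('k, 'm) ring_scheme \<Rightarrow> ('k, 'a) talgebra \<Rightarrow> ('k, 'a) talgebra \<Rightarrow> ('k, 'a) tmap \<Rightarrow> bool" where
  "unital_twisting_map K A B R \<longleftrightarrow> twisting_map K A B R \<and>
     (\<forall>a\<in>carrier (tensor K (space A)).
        fn R (tensor_elem K (space B) (space A) (unit B) a) =
          tensor_elem K (space A) (space B) a (unit B)) \<and>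
     (\<forall>b\<in>carrier (tensor K (space B)).
        fn R (tensor_elem K (space B) (space A) b (unit A)) =
          tensor_elem K (space A) (space B) (unit A) b)"

definition twisted_product ::
    "('k, 'm) ring_scheme \<Rightarrow> ('k, 'a) talgebra \<Rightarrow> ('k, 'a) tmap \<Rightarrow> ('k, 'a) talgebra \<Rightarrow>
     ('k, 'a) talgebra" where
  "twisted_product K A R B =
    \<lparr> space = space A @ space B,
      mu = (mu A \<boxtimes>\<^bsub>K\<^esub> mu B) \<bullet>\<^bsub>K\<^esub> (ident K A \<boxtimes>\<^bsub>K\<^esub> R \<boxtimes>\<^bsub>K\<^esub> ident K B),
      unit = tensor_elem K (space A) (space B) (unit A) (unit B) \<rparr>"

text \<open>Argument order: algebras \<open>X, Y, Z\<close>, then \<open>R\<^sub>X\<^sub>Y, R\<^sub>Y\<^sub>Z, R\<^sub>X\<^sub>Z\<close>.\<close>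

definition compatible ::
    "('k, 'm) ring_scheme \<Rightarrow> ('k, 'a) talgebra \<Rightarrow> ('k, 'a) talgebra \<Rightarrow> ('k, 'a) talgebra \<Rightarrow>
     ('k, 'a) tmap \<Rightarrow> ('k, 'a) tmap \<Rightarrow> ('k, 'a) tmap \<Rightarrow> bool" where
  "compatible K X Y Z Rxy Ryz Rxz \<longleftrightarrow>
     (ident K X \<boxtimes>\<^bsub>K\<^esub> Ryz) \<bullet>\<^bsub>K\<^esub> (Rxz \<boxtimes>\<^bsub>K\<^esub> ident K Y) \<bullet>\<^bsub>K\<^esub> (ident K Z \<boxtimes>\<^bsub>K\<^esub> Rxy) =
     (Rxy \<boxtimes>\<^bsub>K\<^esub> ident K Z) \<bullet>\<^bsub>K\<^esub> (ident K Y \<boxtimes>\<^bsub>K\<^esub> Rxz) \<bullet>\<^bsub>K\<^esub> (Ryz \<boxtimes>\<^bsub>K\<^esub> ident K X)"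

section \<open>Iterated twisted tensor products\<close>

text \<open>Families of algebras are indexed by \<open>1, \<dots>, n\<close>, and \<open>R i j\<close> with \<open>i < j\<close> is the twisting
  map \<open>A\<^sub>j \<otimes> A\<^sub>i \<rightarrow> A\<^sub>i \<otimes> A\<^sub>j\<close>; values at other indices are irrelevant.\<close>

definition merged_algebra ::
    "('k, 'm) ring_scheme \<Rightarrow> (nat \<Rightarrow> ('k, 'a) talgebra) \<Rightarrow> (nat \<Rightarrow> nat \<Rightarrow> ('k, 'a) tmap) \<Rightarrow>
     nat \<Rightarrow> ('k, 'a) talgebra" where
  "merged_algebra K A R j = twisted_product K (A (j - 1)) (R (j - 1) j) (A j)"

text \<open>The map \<open>T\<^sup>i\<close> belonging to \<open>D\<^sub>j = A\<^bsub>j-1\<^esub> \<otimes> A\<^sub>j\<close>, for \<open>i\<close> different from \<open>j - 1\<close> and \<open>j\<close>.\<close>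

definition merged_twist ::
    "('k, 'm) ring_scheme \<Rightarrow> (nat \<Rightarrow> ('k, 'a) talgebra) \<Rightarrow> (nat \<Rightarrow> nat \<Rightarrow> ('k, 'a) tmap) \<Rightarrow>
     nat \<Rightarrow> nat \<Rightarrow> ('k, 'a) tmap" where
  "merged_twist K A R j i =
    (if i < j
     then (R i (j - 1) \<boxtimes>\<^bsub>K\<^esub> ident K (A j)) \<bullet>\<^bsub>K\<^esub> (ident K (A (j - 1)) \<boxtimes>\<^bsub>K\<^esub> R i j)
     else (ident K (A (j - 1)) \<boxtimes>\<^bsub>K\<^esub> R j i) \<bullet>\<^bsub>K\<^esub> (R (j - 1) i \<boxtimes>\<^bsub>K\<^esub> ident K (A j)))"

text \<open>The list \<open>A\<^sub>1, \<dots>, A\<^bsub>j-2\<^esub>, D\<^sub>j, A\<^bsub>j+1\<^esub>, \<dots>, A\<^sub>n\<close>, renumbered by \<open>1, \<dots>, n - 1\<close> (so that \<open>D\<^sub>j\<close>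
  is at position \<open>j - 1\<close>), together with its twisting maps.\<close>

definition old_index :: "nat \<Rightarrow> nat \<Rightarrow> nat" where
  "old_index j p = (if p < j then p else p + 1)"

definition merge_algebras ::
    "('k, 'm) ring_scheme \<Rightarrow> (nat \<Rightarrow> ('k, 'a) talgebra) \<Rightarrow> (nat \<Rightarrow> nat \<Rightarrow> ('k, 'a) tmap) \<Rightarrow>
     nat \<Rightarrow> nat \<Rightarrow> ('k, 'a) talgebra" where
  "merge_algebras K A R j p =
    (if p = j - 1 then merged_algebra K A R j else A (old_index j p))"

definition merge_twists ::
    "('k, 'm) ring_scheme \<Rightarrow> (nat \<Rightarrow> ('k, 'a) talgebra) \<Rightarrow> (nat \<Rightarrow> nat \<Rightarrow> ('k, 'a) tmap) \<Rightarrow>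
     nat \<Rightarrow> nat \<Rightarrow> nat \<Rightarrow> ('k, 'a) tmap" where
  "merge_twists K A R j p q =
    (if p = j - 1 then merged_twist K A R j (old_index j q)
     else if q = j - 1 then merged_twist K A R j (old_index j p)
     else R (old_index j p) (old_index j q))"

definition twisting_system ::
    "('k, 'm) ring_scheme \<Rightarrow> nat \<Rightarrow> (nat \<Rightarrow> ('k, 'a) talgebra) \<Rightarrow> (nat \<Rightarrow> nat \<Rightarrow> ('k, 'a) tmap) \<Rightarrow>
     bool" where
  "twisting_system K n A R \<longleftrightarrow>
     (\<forall>i. 1 \<le> i \<and> i \<le> n \<longrightarrow> is_talgebra K (A i)) \<and>
     (\<forall>i j. 1 \<le> i \<and> i < j \<and> j \<le> n \<longrightarrow> twisting_map K (A i) (A j) (R i j)) \<and>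
     (\<forall>i j k. 1 \<le> i \<and> i < j \<and> j < k \<and> k \<le> n \<longrightarrow>
        compatible K (A i) (A j) (A k) (R i j) (R j k) (R i k))"

text \<open>\<open>iterated_product K n A R P\<close>: some way of successively merging adjacent algebras of the list
  \<open>A\<^sub>1, \<dots>, A\<^sub>n\<close> has the result \<open>P\<close>.  That \<open>P\<close> does not depend on the grouping is not built in.\<close>

inductive iterated_product ::
    "('k, 'm) ring_scheme \<Rightarrow> nat \<Rightarrow> (nat \<Rightarrow> ('k, 'a) talgebra) \<Rightarrow> (nat \<Rightarrow> nat \<Rightarrow> ('k, 'a) tmap) \<Rightarrow>
     ('k, 'a) talgebra \<Rightarrow> bool"
  for K where
  two: "twisting_system K 2 A R \<Longrightarrow>
    iterated_product K 2 A R (twisted_product K (A 1) (R 1 2) (A 2))"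
| merge: "3 \<le> n \<Longrightarrow> twisting_system K n A R \<Longrightarrow> 2 \<le> i \<Longrightarrow> i \<le> n \<Longrightarrow>
    iterated_product K (n - 1) (merge_algebras K A R i) (merge_twists K A R i) P \<Longrightarrow>
    iterated_product K n A R P"

end

theory Submission
  imports Defs
begin

text \<open>
  Call a map \<open>f\<close> natural for an algebra \<open>X\<close> if it slides through the crossings with \<open>X\<close>.  Then
  \<open>R\<close> is a twisting map iff both products (and, for unitality, both units) slide through \<open>R\<close>, and
  compatibility of \<open>R\<^sub>X\<^sub>Y, R\<^sub>Y\<^sub>Z, R\<^sub>X\<^sub>Z\<close> says that \<open>R\<^sub>Y\<^sub>Z\<close> is natural for \<open>X\<close>, or equivalently that \<open>R\<^sub>X\<^sub>Y\<close> is natural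
  for \<open>Z\<close>.  Naturality is preserved by composition, by tensor products, and by composing the
  crossings with two neighbours.  The maps \<open>T\<close> are such composite crossings, and the product of
  \<open>D\<^sub>j\<close> is built from natural maps, so everything said about \<open>T\<close> follows formally.

  For the equality of the iterated products, merging \<open>i\<close> and then its right neighbour gives the same
  system as merging \<open>i + 1\<close> and then its left neighbour; by induction on the number of factors the
  product does not depend on the first merge.
\<close>

section \<open>The module structure of a tensor product\<close>

text \<open>Factors are kept in one flat list, so the monoidal structure is strict: there are no
  associators, and tensoring tensor products is appending lists. The price is paid once, by
  constructing the linear extension of a multilinear assignment; afterwards almost everything is an
  equation between arrows, settled by the interchange law.

  Unitality is carried through every merge: before the next merge, the merged product must again be
  an algebra with unit, and the unit of \<open>D\<^sub>j\<close> is a unit because units slide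
  through \<open>R\<close>.

  Equality of products means equality of records: spaces, products and units at once. To compare the
  first merges \<open>i\<close> and \<open>i + 1\<close>, the induction uses both the case of
  \<open>n - 1\<close> factors (each first merge has exactly one result) and the case of
  \<open>n - 2\<close> factors (the common second stage has a result). For \<open>n = 3\<close> the
  second stage is a single algebra, and the equality is the associativity of twisted products
  itself.\<close>

locale tensor_products = cring K for K :: "('k, 'm) ring_scheme" (structure)
begin

section \<open>Words, formal sums and their congruence\<close>

definition modules :: "('k, 'a) module list \<Rightarrow> bool" where
  "modules Ms \<longleftrightarrow> (\<forall>M\<in>set Ms. module K M)"

lemma modules_append [simp]: "modules (Us @ Vs) \<longleftrightarrow> modules Us \<and> modules Vs"
  by (auto simp: modules_def)

lemma modules_Nil [simp]: "modules []"
  by (simp add: modules_def)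

lemma modules_nth: "modules Ms \<Longrightarrow> i < length Ms \<Longrightarrow> module K (Ms ! i)"
  by (simp add: modules_def)

lemma words_length: "w \<in> words Ms \<Longrightarrow> length w = length Ms"
  by (simp add: words_def list_all2_lengthD)

lemma words_Nil_iff [simp]: "w \<in> words [] \<longleftrightarrow> w = []"
  by (simp add: words_def)

lemma words_append:
  "length v = length Us \<Longrightarrow> v @ w \<in> words (Us @ Vs) \<longleftrightarrow> v \<in> words Us \<and> w \<in> words Vs"
  by (simp add: words_def list_all2_append)

lemma words_appendI [simp]: "v \<in> words Us \<Longrightarrow> w \<in> words Vs \<Longrightarrow> v @ w \<in> words (Us @ Vs)"
  by (simp add: words_append words_length)

lemma words_appendE:
  assumes "x \<in> words (Us @ Vs)"
  obtains v w where "x = v @ w" "v \<in> words Us" "w \<in> words Vs"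
  using assms by (auto simp: words_def list_all2_append2)

lemma words_update:
  "w \<in> words Ms \<Longrightarrow> i < length Ms \<Longrightarrow> x \<in> carrier (Ms ! i) \<Longrightarrow> w[i := x] \<in> words Ms"
  by (auto simp: words_def list_all2_conv_all_nth nth_list_update)

lemma words_take_drop:
  assumes "w \<in> words (Us @ Vs)"
  shows "take (length Us) w \<in> words Us" "drop (length Us) w \<in> words Vs"
  using assms by (auto elim!: words_appendE simp: words_length)

lemma formal_sums_Nil [simp]: "[] \<in> formal_sums K Ms"
  by (simp add: formal_sums_def)

lemma formal_sums_Cons [simp]:
  "(c, w) # s \<in> formal_sums K Ms \<longleftrightarrow> c \<in> carrier K \<and> w \<in> words Ms \<and> s \<in> formal_sums K Ms"
  by (auto simp: formal_sums_def)

lemma formal_sums_append [simp]: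
  "s @ t \<in> formal_sums K Ms \<longleftrightarrow> s \<in> formal_sums K Ms \<and> t \<in> formal_sums K Ms"
  by (auto simp: formal_sums_def)

lemma formal_sums_induct [consumes 1, case_names Nil Cons]:
  assumes "s \<in> formal_sums K Ms"
    and "P []"
    and "\<And>c w s. c \<in> carrier K \<Longrightarrow> w \<in> words Ms \<Longrightarrow> s \<in> formal_sums K Ms \<Longrightarrow> P s \<Longrightarrow> P ((c, w) # s)"
  shows "P s"
  using assms(1) by (induction s) (auto intro: assms(2,3))

lemma tensor_eq_closed:
  assumes "tensor_eq K Ms s t" "modules Ms"
  shows "s \<in> formal_sums K Ms \<and> t \<in> formal_sums K Ms"
  using assms
proof (induction)
  case (add_entry c w i x y)
  interpret M: module K "Ms ! i" using add_entry by (simp add: modules_nth)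
  show ?case using add_entry by (simp add: words_update)
next
  case (smult_entry c r w i x)
  interpret M: module K "Ms ! i" using smult_entry by (simp add: modules_nth)
  show ?case using smult_entry by (simp add: words_update)
qed auto

lemma tensor_class_eqI: "tensor_eq K Ms s t \<Longrightarrow> tensor_class K Ms s = tensor_class K Ms t"
  by (auto simp: tensor_class_def intro: tensor_eq.sym tensor_eq.trans)

text \<open>The operations of \<open>tensor\<close> are unions over all representatives. Such a
  union collapses to one value as soon as the value does not depend on the representative; the union
  is not empty because the congruence is reflexive.\<close>

lemma tensor_class_UN_eq:
  assumes "s \<in> formal_sums K Ms" "\<And>s'. tensor_eq K Ms s s' \<Longrightarrow> F s' = F s"
  shows "(\<Union>s'\<in>tensor_class K Ms s. F s') = F s"
proof -
  have F: "F s' = F s" if "s' \<in> tensor_class K Ms s" for s'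
    using that assms(2)[of s'] by (simp add: tensor_class_def)
  have "s \<in> tensor_class K Ms s"
    using tensor_eq.refl[OF assms(1)] by (simp add: tensor_class_def)
  then have "tensor_class K Ms s \<noteq> {}"
    by blast
  then show ?thesis
    by (rule SUP_eq_const) (rule F)
qed

lemma tensor_carrier_induct [consumes 1, case_names cls]:
  assumes "x \<in> carrier (tensor K Ms)"
    and "\<And>s. s \<in> formal_sums K Ms \<Longrightarrow> P (tensor_class K Ms s)"
  shows "P x"
  using assms by (auto simp: tensor_def)

lemma tensor_class_closed [simp]:
  "s \<in> formal_sums K Ms \<Longrightarrow> tensor_class K Ms s \<in> carrier (tensor K Ms)"
  by (simp add: tensor_def)

lemma tensor_zero: "\<zero>\<^bsub>tensor K Ms\<^esub> = tensor_class K Ms []"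
  by (simp add: tensor_def)

section \<open>Addition and scalar multiplication on classes\<close>

lemma tensor_add:
  assumes "s \<in> formal_sums K Ms" "t \<in> formal_sums K Ms"
  shows "tensor_class K Ms s \<oplus>\<^bsub>tensor K Ms\<^esub> tensor_class K Ms t = tensor_class K Ms (s @ t)"
proof -
  have "tensor_class K Ms s \<oplus>\<^bsub>tensor K Ms\<^esub> tensor_class K Ms t =
      (\<Union>s'\<in>tensor_class K Ms s. \<Union>t'\<in>tensor_class K Ms t. tensor_class K Ms (s' @ t'))"
    by (simp add: tensor_def)
  also have "\<dots> = (\<Union>s'\<in>tensor_class K Ms s. tensor_class K Ms (s' @ t))"
    by (rule SUP_cong[OF HOL.refl], rule tensor_class_UN_eq[OF assms(2)], rule tensor_class_eqI)
      (auto simp: tensor_class_def intro: tensor_eq.intros)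
  also have "\<dots> = tensor_class K Ms (s @ t)"
    by (rule tensor_class_UN_eq[OF assms(1)], rule tensor_class_eqI)
      (auto intro: tensor_eq.intros assms)
  finally show ?thesis .
qed

definition scale :: "'k \<Rightarrow> ('k, 'a) formal_sum \<Rightarrow> ('k, 'a) formal_sum" where
  "scale c s = map (\<lambda>(d, w). (c \<otimes> d, w)) s"

lemma scale_simps [simp]:
  "scale c [] = []"
  "scale c ((d, w) # s) = (c \<otimes> d, w) # scale c s"
  "scale c (s @ t) = scale c s @ scale c t"
  by (simp_all add: scale_def)

lemma scale_closed [simp]:
  "c \<in> carrier K \<Longrightarrow> s \<in> formal_sums K Ms \<Longrightarrow> scale c s \<in> formal_sums K Ms"
  by (induction s) auto

lemma tensor_eq_scale:
  assumes "tensor_eq K Ms s t" "c \<in> carrier K"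
  shows "tensor_eq K Ms (scale c s) (scale c t)"
  using assms
proof (induction)
  case (zero w)
  then show ?case by (simp add: tensor_eq.zero)
next
  case (add d e w)
  then show ?case by (simp add: r_distr tensor_eq.add)
next
  case (add_entry d w i x y)
  then show ?case by (simp add: tensor_eq.add_entry)
next
  case (smult_entry d r w i x)
  then show ?case using tensor_eq.smult_entry[of "c \<otimes> d" K r w Ms i x] by (simp add: m_assoc)
qed (auto intro: tensor_eq.intros)

lemma tensor_smult:
  assumes "s \<in> formal_sums K Ms" "c \<in> carrier K"
  shows "c \<odot>\<^bsub>tensor K Ms\<^esub> tensor_class K Ms s = tensor_class K Ms (scale c s)"
proof -
  have "c \<odot>\<^bsub>tensor K Ms\<^esub> tensor_class K Ms s =
      (\<Union>s'\<in>tensor_class K Ms s. tensor_class K Ms (scale c s'))"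
    by (simp add: tensor_def scale_def)
  also have "\<dots> = tensor_class K Ms (scale c s)"
    by (rule tensor_class_UN_eq[OF assms(1)], rule tensor_class_eqI)
      (auto intro: tensor_eq_scale tensor_eq.sym assms)
  finally show ?thesis .
qed

lemma tensor_eq_scale_zero:
  "s \<in> formal_sums K Ms \<Longrightarrow> tensor_eq K Ms (scale \<zero> s) []"
proof (induction rule: formal_sums_induct)
  case (Cons c w s)
  then show ?case
    using tensor_eq.append[OF tensor_eq.zero[of w Ms K] Cons.IH] by simp
qed (simp add: tensor_eq.refl)

lemma tensor_eq_scale_add:
  assumes "s \<in> formal_sums K Ms" "c \<in> carrier K" "d \<in> carrier K"
  shows "tensor_eq K Ms (scale (c \<oplus> d) s) (scale c s @ scale d s)"
  using assms(1)
proof (induction rule: formal_sums_induct)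
  case (Cons e w s)
  have "tensor_eq K Ms (scale (c \<oplus> d) ((e, w) # s))
      ([(c \<otimes> e, w), (d \<otimes> e, w)] @ (scale c s @ scale d s))"
    using tensor_eq.append[OF tensor_eq.add[of "c \<otimes> e" K "d \<otimes> e" w Ms] Cons.IH] Cons.hyps assms
    by (simp add: l_distr)
  \<comment> \<open>The \<open>d\<close>-term of the head has to move past \<open>scale c s\<close>
    to separate the \<open>c\<close>-terms from the \<open>d\<close>-terms.\<close>
  also have "tensor_eq K Ms \<dots> ([(c \<otimes> e, w)] @ (scale c s @ [(d \<otimes> e, w)]) @ scale d s)"
    using tensor_eq.append[OF tensor_eq.refl tensor_eq.append[OF tensor_eq.commute tensor_eq.refl],
        of "[(c \<otimes> e, w)]" K Ms "[(d \<otimes> e, w)]" "scale c s" "scale d s"] Cons.hyps assms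
    by simp
  finally (tensor_eq.trans) show ?case by simp
qed (simp add: tensor_eq.refl)

lemma scale_one: "s \<in> formal_sums K Ms \<Longrightarrow> scale \<one> s = s"
  by (induction rule: formal_sums_induct) auto

lemma scale_scale:
  "s \<in> formal_sums K Ms \<Longrightarrow> c \<in> carrier K \<Longrightarrow> d \<in> carrier K \<Longrightarrow>
    scale (c \<otimes> d) s = scale c (scale d s)"
  by (induction rule: formal_sums_induct) (auto simp: m_assoc)

lemma tensor_class_append_commute:
  "s \<in> formal_sums K Ms \<Longrightarrow> t \<in> formal_sums K Ms \<Longrightarrow>
    tensor_class K Ms (s @ t) = tensor_class K Ms (t @ s)"
  by (intro tensor_class_eqI tensor_eq.commute)

lemma tensor_module: "module K (tensor K Ms)"
proof (rule moduleI)
  show "abelian_group (tensor K Ms)"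
  proof (rule abelian_groupI)
    fix x assume "x \<in> carrier (tensor K Ms)"
    then show "\<exists>y\<in>carrier (tensor K Ms). y \<oplus>\<^bsub>tensor K Ms\<^esub> x = \<zero>\<^bsub>tensor K Ms\<^esub>"
    proof (induction rule: tensor_carrier_induct)
      case (cls s)
      \<comment> \<open>The additive inverse is the multiple by minus one: the coefficients add up
        to zero, and a sum with zero coefficients is congruent to the empty one.\<close>
      have "tensor_class K Ms (scale (\<ominus> \<one>) s) \<oplus>\<^bsub>tensor K Ms\<^esub> tensor_class K Ms s =
          tensor_class K Ms (scale (\<ominus> \<one>) s @ scale \<one> s)"
        using cls by (simp add: tensor_add scale_one)
      also have "\<dots> = tensor_class K Ms (scale (\<ominus> \<one> \<oplus> \<one>) s)"
        using tensor_eq_scale_add[OF cls, of "\<ominus> \<one>" \<one>]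
        by (intro tensor_class_eqI[OF tensor_eq.sym]) simp
      also have "\<dots> = \<zero>\<^bsub>tensor K Ms\<^esub>"
        using cls by (simp add: l_neg tensor_zero tensor_class_eqI tensor_eq_scale_zero)
      finally show ?case using cls by (metis a_inv_closed one_closed scale_closed tensor_class_closed)
    qed
  next
    fix x y assume "x \<in> carrier (tensor K Ms)" "y \<in> carrier (tensor K Ms)"
    then show "x \<oplus>\<^bsub>tensor K Ms\<^esub> y = y \<oplus>\<^bsub>tensor K Ms\<^esub> x"
      by (auto elim!: tensor_carrier_induct simp: tensor_add tensor_class_append_commute)
  next
    fix x y z
    assume "x \<in> carrier (tensor K Ms)" "y \<in> carrier (tensor K Ms)" "z \<in> carrier (tensor K Ms)"
    then show "x \<oplus>\<^bsub>tensor K Ms\<^esub> y \<oplus>\<^bsub>tensor K Ms\<^esub> z = x \<oplus>\<^bsub>tensor K Ms\<^esub> (y \<oplus>\<^bsub>tensor K Ms\<^esub> z)"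
      by (auto elim!: tensor_carrier_induct simp: tensor_add)
  qed (auto elim!: tensor_carrier_induct simp: tensor_add tensor_zero)
next
  fix a b x assume "a \<in> carrier K" "b \<in> carrier K" "x \<in> carrier (tensor K Ms)"
  then show "(a \<oplus> b) \<odot>\<^bsub>tensor K Ms\<^esub> x = a \<odot>\<^bsub>tensor K Ms\<^esub> x \<oplus>\<^bsub>tensor K Ms\<^esub> b \<odot>\<^bsub>tensor K Ms\<^esub> x"
    by (auto elim!: tensor_carrier_induct
        simp: tensor_add tensor_smult tensor_class_eqI[OF tensor_eq_scale_add])
qed (auto elim!: tensor_carrier_induct
    simp: tensor_add tensor_smult scale_scale scale_one intro: is_cring)

section \<open>The universal property\<close>

definition multilinear ::
    "('k, 'a) module list \<Rightarrow> ('k, 'b) module \<Rightarrow> ('a list \<Rightarrow> 'b) \<Rightarrow> bool" where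
  "multilinear Ms N \<phi> \<longleftrightarrow> \<phi> \<in> words Ms \<rightarrow> carrier N \<and>
     (\<forall>w\<in>words Ms. \<forall>i<length Ms.
        (\<forall>x\<in>carrier (Ms ! i). \<forall>y\<in>carrier (Ms ! i).
           \<phi> (w[i := x \<oplus>\<^bsub>Ms ! i\<^esub> y]) = \<phi> (w[i := x]) \<oplus>\<^bsub>N\<^esub> \<phi> (w[i := y])) \<and>
        (\<forall>r\<in>carrier K. \<forall>x\<in>carrier (Ms ! i).
           \<phi> (w[i := r \<odot>\<^bsub>Ms ! i\<^esub> x]) = r \<odot>\<^bsub>N\<^esub> \<phi> (w[i := x])))"

lemma multilinearD:
  assumes "multilinear Ms N \<phi>"
  shows "\<And>w. w \<in> words Ms \<Longrightarrow> \<phi> w \<in> carrier N"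
    and "\<And>w i x y. w \<in> words Ms \<Longrightarrow> i < length Ms \<Longrightarrow> x \<in> carrier (Ms ! i) \<Longrightarrow>
      y \<in> carrier (Ms ! i) \<Longrightarrow> \<phi> (w[i := x \<oplus>\<^bsub>Ms ! i\<^esub> y]) = \<phi> (w[i := x]) \<oplus>\<^bsub>N\<^esub> \<phi> (w[i := y])"
    and "\<And>w i r x. w \<in> words Ms \<Longrightarrow> i < length Ms \<Longrightarrow> r \<in> carrier K \<Longrightarrow>
      x \<in> carrier (Ms ! i) \<Longrightarrow> \<phi> (w[i := r \<odot>\<^bsub>Ms ! i\<^esub> x]) = r \<odot>\<^bsub>N\<^esub> \<phi> (w[i := x])"
  using assms by (auto simp: multilinear_def)

text \<open>This is the linear extension of \<phi> on the level of formal sums, before the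
  congruence is divided out.\<close>

fun evaluate :: "('k, 'b) module \<Rightarrow> ('a list \<Rightarrow> 'b) \<Rightarrow> ('k, 'a) formal_sum \<Rightarrow> 'b" where
  "evaluate N \<phi> [] = \<zero>\<^bsub>N\<^esub>"
| "evaluate N \<phi> ((c, w) # s) = c \<odot>\<^bsub>N\<^esub> \<phi> w \<oplus>\<^bsub>N\<^esub> evaluate N \<phi> s"

context
  fixes Ms :: "('k, 'a) module list" and N :: "('k, 'b) module" and \<phi> :: "'a list \<Rightarrow> 'b"
  assumes N: "module K N" and \<phi>: "\<phi> \<in> words Ms \<rightarrow> carrier N"
begin

interpretation N: module K N by (rule N)

lemma evaluate_closed: "s \<in> formal_sums K Ms \<Longrightarrow> evaluate N \<phi> s \<in> carrier N"
  by (induction rule: formal_sums_induct) (use \<phi> in auto)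

lemma evaluate_append:
  "s \<in> formal_sums K Ms \<Longrightarrow> t \<in> formal_sums K Ms \<Longrightarrow>
    evaluate N \<phi> (s @ t) = evaluate N \<phi> s \<oplus>\<^bsub>N\<^esub> evaluate N \<phi> t"
  by (induction rule: formal_sums_induct)
    (use \<phi> in \<open>auto simp: evaluate_closed N.a_assoc Pi_iff\<close>)

lemma evaluate_scale:
  "s \<in> formal_sums K Ms \<Longrightarrow> c \<in> carrier K \<Longrightarrow> evaluate N \<phi> (scale c s) = c \<odot>\<^bsub>N\<^esub> evaluate N \<phi> s"
  by (induction rule: formal_sums_induct)
    (use \<phi> in \<open>auto simp: evaluate_closed N.smult_r_distr N.smult_assoc1 Pi_iff\<close>)

text \<open>Each generating rule of the congruence is an identity that holds in every module under a
  multilinear assignment. This is what lets a multilinear \<phi> descend to the quotient.\<close>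

lemma evaluate_tensor_eq:
  assumes "tensor_eq K Ms s t" "modules Ms" and m: "multilinear Ms N \<phi>"
  shows "evaluate N \<phi> s = evaluate N \<phi> t"
  using assms(1,2)
proof (induction)
  case (append s s' t t')
  then show ?case by (simp add: evaluate_append tensor_eq_closed)
next
  case (commute s t)
  then show ?case by (simp add: evaluate_append evaluate_closed N.a_comm)
next
  case (zero w)
  then show ?case using multilinearD(1)[OF m] by simp
next
  case (add c d w)
  then show ?case using multilinearD(1)[OF m, of w] by (simp add: N.smult_l_distr)
next
  case (add_entry c w i x y)
  then show ?case
    using multilinearD(1)[OF m words_update] by (simp add: multilinearD(2)[OF m] N.smult_r_distr)
next
  case (smult_entry c r w i x)
  then show ?case
    using multilinearD(1)[OF m words_update] by (simp add: multilinearD(3)[OF m] N.smult_assoc1)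
qed auto

end

lemma evaluate_cong:
  "s \<in> formal_sums K Ms \<Longrightarrow> (\<And>w. w \<in> words Ms \<Longrightarrow> \<phi> w = \<psi> w) \<Longrightarrow> evaluate N \<phi> s = evaluate N \<psi> s"
  by (induction rule: formal_sums_induct) auto

lemma linear_mapsD:
  assumes "f \<in> linear_maps K U V"
  shows "src f = U" "tgt f = V"
    "\<And>x. x \<in> carrier (tensor K U) \<Longrightarrow> fn f x \<in> carrier (tensor K V)"
    "fn f \<in> extensional (carrier (tensor K U))"
    "\<And>x y. x \<in> carrier (tensor K U) \<Longrightarrow> y \<in> carrier (tensor K U) \<Longrightarrow>
        fn f (x \<oplus>\<^bsub>tensor K U\<^esub> y) = fn f x \<oplus>\<^bsub>tensor K V\<^esub> fn f y"
    "\<And>c x. c \<in> carrier K \<Longrightarrow> x \<in> carrier (tensor K U) \<Longrightarrow>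
        fn f (c \<odot>\<^bsub>tensor K U\<^esub> x) = c \<odot>\<^bsub>tensor K V\<^esub> fn f x"
  using assms by (auto simp: linear_maps_def PiE_iff)

lemma linear_maps_zero:
  assumes "f \<in> linear_maps K U V"
  shows "fn f \<zero>\<^bsub>tensor K U\<^esub> = \<zero>\<^bsub>tensor K V\<^esub>"
proof -
  interpret U: module K "tensor K U" by (rule tensor_module)
  interpret V: module K "tensor K V" by (rule tensor_module)
  show ?thesis
    using linear_mapsD(3)[OF assms U.zero_closed] linear_mapsD(6)[OF assms zero_closed U.zero_closed]
    by simp
qed

lemma pure_tensor_closed [simp]: "w \<in> words Ms \<Longrightarrow> pure_tensor K Ms w \<in> carrier (tensor K Ms)"
  by (simp add: pure_tensor_def)

lemma pure_tensor_multilinear: "modules Ms \<Longrightarrow> multilinear Ms (tensor K Ms) (pure_tensor K Ms)"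
  by (simp add: multilinear_def pure_tensor_def tensor_add tensor_smult words_update
      tensor_class_eqI[OF tensor_eq.add_entry] tensor_class_eqI[OF tensor_eq.smult_entry])

lemma tensor_class_Cons:
  assumes "c \<in> carrier K" "w \<in> words Ms" "s \<in> formal_sums K Ms"
  shows "tensor_class K Ms ((c, w) # s) =
    c \<odot>\<^bsub>tensor K Ms\<^esub> pure_tensor K Ms w \<oplus>\<^bsub>tensor K Ms\<^esub> tensor_class K Ms s"
  using assms by (simp add: pure_tensor_def tensor_smult tensor_add)

lemma tensor_induct [consumes 1, case_names zero pure add]:
  assumes "x \<in> carrier (tensor K Ms)"
    and "P \<zero>\<^bsub>tensor K Ms\<^esub>"
    and "\<And>c w. c \<in> carrier K \<Longrightarrow> w \<in> words Ms \<Longrightarrow> P (c \<odot>\<^bsub>tensor K Ms\<^esub> pure_tensor K Ms w)"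
    and "\<And>x y. x \<in> carrier (tensor K Ms) \<Longrightarrow> y \<in> carrier (tensor K Ms) \<Longrightarrow> P x \<Longrightarrow> P y \<Longrightarrow>
      P (x \<oplus>\<^bsub>tensor K Ms\<^esub> y)"
  shows "P x"
  using assms(1)
proof (induction rule: tensor_carrier_induct)
  interpret module K "tensor K Ms" by (rule tensor_module)
  case (cls s)
  then show ?case
  proof (induction rule: formal_sums_induct)
    case Nil
    show ?case using assms(2) by (simp add: tensor_zero)
  next
    case (Cons c w s)
    then show ?case
      by (simp add: tensor_class_Cons) (rule assms(4), simp_all add: assms(3))
  qed
qed

text \<open>Pure tensors span, which is the uniqueness half of the universal property;
  extensionality of \<open>fn\<close> turns agreement on the carrier into equality of
  records.\<close>

lemma linear_maps_eqI:
  assumes f: "f \<in> linear_maps K U V" and g: "g \<in> linear_maps K U V"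
    and eq: "\<And>w. w \<in> words U \<Longrightarrow> fn f (pure_tensor K U w) = fn g (pure_tensor K U w)"
  shows "f = g"
proof -
  have "fn f x = fn g x" if "x \<in> carrier (tensor K U)" for x
    using that
    by (induction rule: tensor_induct)
      (simp_all add: linear_maps_zero[OF f] linear_maps_zero[OF g] linear_mapsD(5,6)[OF f]
        linear_mapsD(5,6)[OF g] eq)
  then have "fn f = fn g"
    using linear_mapsD(4)[OF f] linear_mapsD(4)[OF g] by (rule extensionalityI[rotated 2])
  then show ?thesis
    using linear_mapsD(1,2)[OF f] linear_mapsD(1,2)[OF g] by (intro tmap.equality) simp_all
qed

text \<open>The existence half. Together with \<open>linear_maps_eqI\<close> it shows that the
  description in the definition of \<open>linear_extension\<close> has exactly one solution.\<close>

lemma linear_extension: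
  assumes "modules U" and m: "multilinear U (tensor K V) \<phi>"
  shows "linear_extension K U V \<phi> \<in> linear_maps K U V"
    and "w \<in> words U \<Longrightarrow> fn (linear_extension K U V \<phi>) (pure_tensor K U w) = \<phi> w"
proof -
  interpret V: module K "tensor K V" by (rule tensor_module)
  have \<phi>: "\<phi> \<in> words U \<rightarrow> carrier (tensor K V)"
    using m by (auto simp: multilinear_def)
  note ev = evaluate_closed[OF tensor_module \<phi>] evaluate_append[OF tensor_module \<phi>]
    evaluate_scale[OF tensor_module \<phi>]
  \<comment> \<open>The value at a class is read off from an arbitrary representative;
    \<open>evaluate_tensor_eq\<close> makes the choice harmless. The restricted abstraction provides
    the extensionality demanded by \<open>linear_maps\<close>.\<close>
  define h where "h = (\<lambda>x\<in>carrier (tensor K U).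
    evaluate (tensor K V) \<phi> (SOME s. s \<in> formal_sums K U \<and> x = tensor_class K U s))"
  have h: "h (tensor_class K U s) = evaluate (tensor K V) \<phi> s" if s: "s \<in> formal_sums K U" for s
  proof -
    define t where "t = (SOME t. t \<in> formal_sums K U \<and> tensor_class K U s = tensor_class K U t)"
    have "t \<in> formal_sums K U \<and> tensor_class K U s = tensor_class K U t"
      unfolding t_def by (rule someI) (use s in simp)
    then have "tensor_eq K U s t"
      using tensor_eq.refl[of t K U] by (auto simp: tensor_class_def)
    then show ?thesis
      using s evaluate_tensor_eq[OF tensor_module \<phi> _ assms] by (simp add: h_def t_def)
  qed
  define f where "f = \<lparr>src = U, tgt = V, fn = h\<rparr>"
  have f: "f \<in> linear_maps K U V"
    by (auto simp: linear_maps_def f_def tensor_add tensor_smult h ev elim!: tensor_carrier_induct)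
      (auto simp: h_def)
  have f_pure: "fn f (pure_tensor K U w) = \<phi> w" if "w \<in> words U" for w
    using \<phi> that by (simp add: f_def pure_tensor_def h Pi_iff)
  have "linear_extension K U V \<phi> = f"
    unfolding linear_extension_def
  proof (rule the_equality)
    show "g = f"
      if "g \<in> linear_maps K U V \<and> (\<forall>w\<in>words U. fn g (pure_tensor K U w) = \<phi> w)" for g
      using that f f_pure by (intro linear_maps_eqI[of g U V f]) simp_all
  qed (simp add: f f_pure)
  then show "linear_extension K U V \<phi> \<in> linear_maps K U V"
    and "w \<in> words U \<Longrightarrow> fn (linear_extension K U V \<phi>) (pure_tensor K U w) = \<phi> w"
    by (simp_all add: f f_pure)
qed

section \<open>The tensor product of elements\<close>

definition juxtapose :: "('k, 'a) formal_sum \<Rightarrow> ('k, 'a) formal_sum \<Rightarrow> ('k, 'a) formal_sum" where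
  "juxtapose s t = [(c \<otimes> d, v @ w). (c, v) \<leftarrow> s, (d, w) \<leftarrow> t]"

lemma juxtapose_simps [simp]:
  "juxtapose [] t = []"
  "juxtapose ((c, v) # s) t = map (\<lambda>(d, w). (c \<otimes> d, v @ w)) t @ juxtapose s t"
  by (simp_all add: juxtapose_def)

lemma juxtapose_closed:
  assumes "s \<in> formal_sums K Us" "t \<in> formal_sums K Vs"
  shows "juxtapose s t \<in> formal_sums K (Us @ Vs)"
  using assms(1)
proof (induction rule: formal_sums_induct)
  case (Cons c v s)
  have "map (\<lambda>(d, w). (c \<otimes> d, v @ w)) t \<in> formal_sums K (Us @ Vs)"
    using assms(2) Cons(1,2) by (induction rule: formal_sums_induct) auto
  with Cons show ?case by simp
qed simp

section \<open>Bilinearity and associativity of the tensor product of elements\<close>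

context
  fixes Ms :: "('k, 'a) module list" and N :: "('k, 'b) module"
  assumes N: "module K N"
begin

interpretation N: module K N by (rule N)

lemma multilinear_zero: "multilinear Ms N (\<lambda>_. \<zero>\<^bsub>N\<^esub>)"
  by (simp add: multilinear_def)

lemma multilinear_smult:
  assumes "modules Ms" "c \<in> carrier K" "multilinear Ms N \<phi>"
  shows "multilinear Ms N (\<lambda>w. c \<odot>\<^bsub>N\<^esub> \<phi> w)"
  using assms(2) multilinearD[OF assms(3)]
  by (simp add: multilinear_def words_update N.smult_r_distr m_comm
      flip: N.smult_assoc1)

lemma multilinear_add:
  assumes "modules Ms" "multilinear Ms N \<phi>" "multilinear Ms N \<psi>"
  shows "multilinear Ms N (\<lambda>w. \<phi> w \<oplus>\<^bsub>N\<^esub> \<psi> w)"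
  using multilinearD[OF assms(2)] multilinearD[OF assms(3)]
  by (simp add: multilinear_def words_update N.smult_r_distr N.a_ac)

lemma multilinear_evaluate:
  assumes "modules Ms" "t \<in> formal_sums K Ns" "\<And>w. w \<in> words Ns \<Longrightarrow> multilinear Ms N (\<lambda>v. \<psi> v w)"
  shows "multilinear Ms N (\<lambda>v. evaluate N (\<psi> v) t)"
  using assms(2)
  by (induction rule: formal_sums_induct)
    (simp_all add: assms multilinear_zero multilinear_smult multilinear_add)

lemma evaluate_add:
  assumes "s \<in> formal_sums K Ms" "\<phi> \<in> words Ms \<rightarrow> carrier N" "\<psi> \<in> words Ms \<rightarrow> carrier N"
  shows "evaluate N (\<lambda>w. \<phi> w \<oplus>\<^bsub>N\<^esub> \<psi> w) s = evaluate N \<phi> s \<oplus>\<^bsub>N\<^esub> evaluate N \<psi> s"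
  using assms(1)
proof (induction rule: formal_sums_induct)
  case (Cons c w s)
  with assms(2,3) show ?case
    by (auto simp: N.smult_r_distr N.a_ac evaluate_closed[OF N assms(2)]
        evaluate_closed[OF N assms(3)] Pi_iff)
qed simp

lemma evaluate_smult:
  assumes "s \<in> formal_sums K Ms" "c \<in> carrier K" "\<phi> \<in> words Ms \<rightarrow> carrier N"
  shows "evaluate N (\<lambda>w. c \<odot>\<^bsub>N\<^esub> \<phi> w) s = c \<odot>\<^bsub>N\<^esub> evaluate N \<phi> s"
  using assms(1)
proof (induction rule: formal_sums_induct)
  case (Cons d w s)
  with assms(2,3) show ?case
    by (auto simp: N.smult_r_distr m_comm evaluate_closed[OF N assms(3)] Pi_iff
        simp flip: N.smult_assoc1)
qed (simp add: assms)

end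

context
  fixes Us Vs :: "('k, 'a) module list"
  assumes Us: "modules Us" and Vs: "modules Vs"
begin

interpretation T: module K "tensor K (Us @ Vs)" by (rule tensor_module)

lemma multilinear_pure_right:
  assumes "v \<in> words Us"
  shows "multilinear Vs (tensor K (Us @ Vs)) (\<lambda>w. pure_tensor K (Us @ Vs) (v @ w))"
proof -
  have m: "multilinear (Us @ Vs) (tensor K (Us @ Vs)) (pure_tensor K (Us @ Vs))"
    using Us Vs by (simp add: pure_tensor_multilinear)
  show ?thesis
    using assms multilinearD(2,3)[OF m words_appendI[OF assms], where i = "length Us + i" for i, simplified]
    by (simp add: multilinear_def list_update_append words_length)
qed

lemma multilinear_pure_left:
  assumes "w \<in> words Vs"
  shows "multilinear Us (tensor K (Us @ Vs)) (\<lambda>v. pure_tensor K (Us @ Vs) (v @ w))"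
proof -
  have m: "multilinear (Us @ Vs) (tensor K (Us @ Vs)) (pure_tensor K (Us @ Vs))"
    using Us Vs by (simp add: pure_tensor_multilinear)
  show ?thesis
    unfolding multilinear_def
  proof (intro conjI ballI allI impI)
    fix v i r x y
    assume v: "v \<in> words Us" and i: "i < length Us" and x: "x \<in> carrier (Us ! i)"
    note D = multilinearD(2,3)[OF m words_appendI[OF v assms], of i]
    show "pure_tensor K (Us @ Vs) (v[i := x \<oplus>\<^bsub>Us ! i\<^esub> y] @ w) =
        pure_tensor K (Us @ Vs) (v[i := x] @ w) \<oplus>\<^bsub>tensor K (Us @ Vs)\<^esub>
        pure_tensor K (Us @ Vs) (v[i := y] @ w)" if "y \<in> carrier (Us ! i)"
      using D(1)[of x y] i x v that by (simp add: list_update_append words_length nth_append)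
    show "pure_tensor K (Us @ Vs) (v[i := r \<odot>\<^bsub>Us ! i\<^esub> x] @ w) =
        r \<odot>\<^bsub>tensor K (Us @ Vs)\<^esub> pure_tensor K (Us @ Vs) (v[i := x] @ w)" if "r \<in> carrier K"
      using D(2)[of r x] i x v that by (simp add: list_update_append words_length nth_append)
  qed (use assms in simp)
qed

text \<open>Written as a double evaluation, the product of two formal sums inherits independence of
  representatives and bilinearity from the multilinearity of \<open>pure_tensor\<close> in each
  block of entries.\<close>

lemma juxtapose_evaluate:
  assumes "s \<in> formal_sums K Us" "t \<in> formal_sums K Vs"
  shows "tensor_class K (Us @ Vs) (juxtapose s t) =
    evaluate (tensor K (Us @ Vs))
      (\<lambda>v. evaluate (tensor K (Us @ Vs)) (\<lambda>w. pure_tensor K (Us @ Vs) (v @ w)) t) s"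
  using assms(1)
proof (induction rule: formal_sums_induct)
  case (Cons c v s)
  let ?f = "\<lambda>w. pure_tensor K (Us @ Vs) (v @ w)"
  let ?map = "map (\<lambda>(d, w). (c \<otimes> d, v @ w))"
  have f: "?f \<in> words Vs \<rightarrow> carrier (tensor K (Us @ Vs))"
    using Cons by (auto intro: words_appendI)
  have *: "?map t \<in> formal_sums K (Us @ Vs) \<and>
      tensor_class K (Us @ Vs) (?map t) = c \<odot>\<^bsub>tensor K (Us @ Vs)\<^esub> evaluate (tensor K (Us @ Vs)) ?f t"
    using assms(2)
  proof (induction rule: formal_sums_induct)
    case Nil
    then show ?case using Cons by (simp add: tensor_zero[symmetric])
  next
    case (Cons d w t)
    with \<open>c \<in> carrier K\<close> \<open>v \<in> words Us\<close> show ?case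
      by (simp add: words_appendI tensor_class_Cons T.smult_r_distr T.smult_assoc1
          evaluate_closed[OF tensor_module f])
  qed
  with Cons show ?case
    by (simp add: juxtapose_closed[OF _ assms(2)] tensor_add[symmetric])
qed (simp add: tensor_zero)

lemma tensor_elem_class:
  assumes s: "s \<in> formal_sums K Us" and t: "t \<in> formal_sums K Vs"
  shows "tensor_elem K Us Vs (tensor_class K Us s) (tensor_class K Vs t) =
    tensor_class K (Us @ Vs) (juxtapose s t)"
proof -
  let ?T = "tensor K (Us @ Vs)"
  let ?p = "\<lambda>v w. pure_tensor K (Us @ Vs) (v @ w)"
  \<comment> \<open>A change of the right representative affects only the inner evaluation, a change
    of the left one only the outer evaluation.\<close>
  have cong_right: "tensor_class K (Us @ Vs) (juxtapose s' t') = tensor_class K (Us @ Vs) (juxtapose s' t)"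
    if s': "s' \<in> formal_sums K Us" and t': "tensor_eq K Vs t t'" for s' t'
  proof -
    have t'': "t' \<in> formal_sums K Vs" using tensor_eq_closed[OF t' Vs] by simp
    have "evaluate ?T (?p v) t = evaluate ?T (?p v) t'" if "v \<in> words Us" for v
      by (rule evaluate_tensor_eq[OF tensor_module _ t' Vs multilinear_pure_right])
        (use that in \<open>auto intro: words_appendI\<close>)
    then show ?thesis
      using s' t t'' by (simp add: juxtapose_evaluate cong: evaluate_cong)
  qed
  have cong_left: "tensor_class K (Us @ Vs) (juxtapose s' t) = tensor_class K (Us @ Vs) (juxtapose s t)"
    if s': "tensor_eq K Us s s'" for s'
  proof -
    have m: "multilinear Us ?T (\<lambda>v. evaluate ?T (?p v) t)"
      by (rule multilinear_evaluate[OF tensor_module Us t multilinear_pure_left])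
    have "evaluate ?T (\<lambda>v. evaluate ?T (?p v) t) s = evaluate ?T (\<lambda>v. evaluate ?T (?p v) t) s'"
      by (rule evaluate_tensor_eq[OF tensor_module _ s' Us m])
        (use multilinearD(1)[OF m] in auto)
    then show ?thesis
      using s t tensor_eq_closed[OF s' Us] by (simp add: juxtapose_evaluate)
  qed
  have "tensor_elem K Us Vs (tensor_class K Us s) (tensor_class K Vs t) =
      (\<Union>s'\<in>tensor_class K Us s. \<Union>t'\<in>tensor_class K Vs t. tensor_class K (Us @ Vs) (juxtapose s' t'))"
    by (simp add: tensor_elem_def juxtapose_def)
  also have "\<dots> = (\<Union>s'\<in>tensor_class K Us s. tensor_class K (Us @ Vs) (juxtapose s' t))"
    by (rule SUP_cong[OF HOL.refl], rule tensor_class_UN_eq[OF t], rule cong_right)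
      (auto simp: tensor_class_def dest: tensor_eq_closed[OF _ Us])
  also have "\<dots> = tensor_class K (Us @ Vs) (juxtapose s t)"
    by (rule tensor_class_UN_eq[OF s]) (rule cong_left)
  finally show ?thesis .
qed

lemma tensor_elem_closed [simp]:
  "x \<in> carrier (tensor K Us) \<Longrightarrow> y \<in> carrier (tensor K Vs) \<Longrightarrow>
    tensor_elem K Us Vs x y \<in> carrier (tensor K (Us @ Vs))"
  by (auto elim!: tensor_carrier_induct simp: tensor_elem_class juxtapose_closed)

lemma tensor_elem_pure:
  assumes "v \<in> words Us" "w \<in> words Vs"
  shows "tensor_elem K Us Vs (pure_tensor K Us v) (pure_tensor K Vs w) = pure_tensor K (Us @ Vs) (v @ w)"
  using assms by (simp add: pure_tensor_def tensor_elem_class)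

lemma tensor_elem_evaluate:
  assumes "s \<in> formal_sums K Us" "t \<in> formal_sums K Vs"
  shows "tensor_elem K Us Vs (tensor_class K Us s) (tensor_class K Vs t) =
    evaluate (tensor K (Us @ Vs))
      (\<lambda>v. evaluate (tensor K (Us @ Vs)) (\<lambda>w. pure_tensor K (Us @ Vs) (v @ w)) t) s"
  using assms by (simp add: tensor_elem_class juxtapose_evaluate)

lemma evaluate_pure_closed:
  "v \<in> words Us \<Longrightarrow> t \<in> formal_sums K Vs \<Longrightarrow>
    evaluate (tensor K (Us @ Vs)) (\<lambda>w. pure_tensor K (Us @ Vs) (v @ w)) t \<in> carrier (tensor K (Us @ Vs))"
  by (rule evaluate_closed[OF tensor_module]) (auto intro: words_appendI)

lemma tensor_elem_add_left:
  assumes "x \<in> carrier (tensor K Us)" "y \<in> carrier (tensor K Us)" "z \<in> carrier (tensor K Vs)"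
  shows "tensor_elem K Us Vs (x \<oplus>\<^bsub>tensor K Us\<^esub> y) z =
    tensor_elem K Us Vs x z \<oplus>\<^bsub>tensor K (Us @ Vs)\<^esub> tensor_elem K Us Vs y z"
  using assms
  by (auto elim!: tensor_carrier_induct
      simp: tensor_add tensor_elem_evaluate evaluate_append[OF tensor_module, where Ms = Us] evaluate_pure_closed)

lemma tensor_elem_smult_left:
  assumes "c \<in> carrier K" "x \<in> carrier (tensor K Us)" "z \<in> carrier (tensor K Vs)"
  shows "tensor_elem K Us Vs (c \<odot>\<^bsub>tensor K Us\<^esub> x) z =
    c \<odot>\<^bsub>tensor K (Us @ Vs)\<^esub> tensor_elem K Us Vs x z"
  using assms
  by (auto elim!: tensor_carrier_induct
      simp: tensor_smult tensor_elem_evaluate evaluate_scale[OF tensor_module, where Ms = Us] evaluate_pure_closed)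

lemma tensor_elem_add_right:
  assumes "z \<in> carrier (tensor K Us)" "x \<in> carrier (tensor K Vs)" "y \<in> carrier (tensor K Vs)"
  shows "tensor_elem K Us Vs z (x \<oplus>\<^bsub>tensor K Vs\<^esub> y) =
    tensor_elem K Us Vs z x \<oplus>\<^bsub>tensor K (Us @ Vs)\<^esub> tensor_elem K Us Vs z y"
  using assms
proof (elim tensor_carrier_induct)
  fix r s t assume r: "r \<in> formal_sums K Us" and st: "s \<in> formal_sums K Vs" "t \<in> formal_sums K Vs"
  let ?T = "tensor K (Us @ Vs)"
  let ?e = "\<lambda>t v. evaluate ?T (\<lambda>w. pure_tensor K (Us @ Vs) (v @ w)) t"
  have "evaluate ?T (?e (s @ t)) r = evaluate ?T (\<lambda>v. ?e s v \<oplus>\<^bsub>?T\<^esub> ?e t v) r"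
    by (rule evaluate_cong[OF r], rule evaluate_append[OF tensor_module])
      (auto intro: words_appendI st)
  also have "\<dots> = evaluate ?T (?e s) r \<oplus>\<^bsub>?T\<^esub> evaluate ?T (?e t) r"
    by (rule evaluate_add[OF tensor_module r]) (auto intro: evaluate_pure_closed st)
  finally show "tensor_elem K Us Vs (tensor_class K Us r)
      (tensor_class K Vs s \<oplus>\<^bsub>tensor K Vs\<^esub> tensor_class K Vs t) =
    tensor_elem K Us Vs (tensor_class K Us r) (tensor_class K Vs s) \<oplus>\<^bsub>?T\<^esub>
    tensor_elem K Us Vs (tensor_class K Us r) (tensor_class K Vs t)"
    using r st by (simp add: tensor_add tensor_elem_evaluate)
qed

lemma tensor_elem_smult_right:
  assumes "c \<in> carrier K" "z \<in> carrier (tensor K Us)" "x \<in> carrier (tensor K Vs)"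
  shows "tensor_elem K Us Vs z (c \<odot>\<^bsub>tensor K Vs\<^esub> x) =
    c \<odot>\<^bsub>tensor K (Us @ Vs)\<^esub> tensor_elem K Us Vs z x"
  using assms(2,3)
proof (elim tensor_carrier_induct)
  fix r s assume r: "r \<in> formal_sums K Us" and s: "s \<in> formal_sums K Vs"
  let ?T = "tensor K (Us @ Vs)"
  let ?e = "\<lambda>t v. evaluate ?T (\<lambda>w. pure_tensor K (Us @ Vs) (v @ w)) t"
  have "evaluate ?T (?e (scale c s)) r = evaluate ?T (\<lambda>v. c \<odot>\<^bsub>?T\<^esub> ?e s v) r"
    by (rule evaluate_cong[OF r], rule evaluate_scale[OF tensor_module])
      (auto intro: words_appendI s assms)
  also have "\<dots> = c \<odot>\<^bsub>?T\<^esub> evaluate ?T (?e s) r"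
    by (rule evaluate_smult[OF tensor_module r]) (auto intro: evaluate_pure_closed s assms)
  finally show "tensor_elem K Us Vs (tensor_class K Us r) (c \<odot>\<^bsub>tensor K Vs\<^esub> tensor_class K Vs s) =
    c \<odot>\<^bsub>?T\<^esub> tensor_elem K Us Vs (tensor_class K Us r) (tensor_class K Vs s)"
    using r s assms(1) by (simp add: tensor_smult tensor_elem_evaluate)
qed

lemma tensor_elem_zero:
  "y \<in> carrier (tensor K Vs) \<Longrightarrow> tensor_elem K Us Vs \<zero>\<^bsub>tensor K Us\<^esub> y = \<zero>\<^bsub>tensor K (Us @ Vs)\<^esub>"
  "x \<in> carrier (tensor K Us) \<Longrightarrow> tensor_elem K Us Vs x \<zero>\<^bsub>tensor K Vs\<^esub> = \<zero>\<^bsub>tensor K (Us @ Vs)\<^esub>"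
proof -
  interpret U: module K "tensor K Us" by (rule tensor_module)
  interpret V: module K "tensor K Vs" by (rule tensor_module)
  show "tensor_elem K Us Vs \<zero>\<^bsub>tensor K Us\<^esub> y = \<zero>\<^bsub>tensor K (Us @ Vs)\<^esub>"
    if "y \<in> carrier (tensor K Vs)"
    using tensor_elem_smult_left[OF zero_closed U.zero_closed that] that by simp
  show "tensor_elem K Us Vs x \<zero>\<^bsub>tensor K Vs\<^esub> = \<zero>\<^bsub>tensor K (Us @ Vs)\<^esub>"
    if "x \<in> carrier (tensor K Us)"
    using tensor_elem_smult_right[OF zero_closed that V.zero_closed] that by simp
qed

lemmas tensor_elem_linear = tensor_elem_zero tensor_elem_add_left tensor_elem_add_right
  tensor_elem_smult_left tensor_elem_smult_right

end

lemma tensor_elem_Nil_left: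
  assumes "modules Us" "x \<in> carrier (tensor K Us)"
  shows "tensor_elem K [] Us (pure_tensor K [] []) x = x"
  using assms(2) tensor_elem_linear[of "[]" Us]
  by (induction rule: tensor_induct) (simp_all add: assms(1) tensor_elem_pure)

lemma tensor_elem_Nil_right:
  assumes "modules Us" "x \<in> carrier (tensor K Us)"
  shows "tensor_elem K Us [] x (pure_tensor K [] []) = x"
  using assms(2) tensor_elem_linear[of Us "[]"]
  by (induction rule: tensor_induct) (simp_all add: assms(1) tensor_elem_pure)

lemma tensor_elem_assoc:
  assumes m: "modules Us" "modules Vs" "modules Ws"
    and "x \<in> carrier (tensor K Us)" "y \<in> carrier (tensor K Vs)" "z \<in> carrier (tensor K Ws)"
  shows "tensor_elem K (Us @ Vs) Ws (tensor_elem K Us Vs x y) z =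
    tensor_elem K Us (Vs @ Ws) x (tensor_elem K Vs Ws y z)"
proof -
  interpret U: module K "tensor K Us" by (rule tensor_module)
  interpret V: module K "tensor K Vs" by (rule tensor_module)
  interpret W: module K "tensor K Ws" by (rule tensor_module)
  have mm: "modules (Us @ Vs)" "modules (Vs @ Ws)" using m by simp_all
  note lin = tensor_elem_linear[OF m(1,2)] tensor_elem_linear[OF m(2,3)]
    tensor_elem_linear[OF mm(1) m(3), simplified] tensor_elem_linear[OF m(1) mm(2), simplified]
    tensor_elem_closed[OF m(1,2)] tensor_elem_closed[OF m(2,3)]
  let ?P = "\<lambda>x y z. tensor_elem K (Us @ Vs) Ws (tensor_elem K Us Vs x y) z =
    tensor_elem K Us (Vs @ Ws) x (tensor_elem K Vs Ws y z)"
  \<comment> \<open>The arguments are generalized from pure tensors one at a time. On three pure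
    tensors both sides are the pure tensor of the concatenated words.\<close>
  have 1: "?P (pure_tensor K Us u) (pure_tensor K Vs v) z"
    if "u \<in> words Us" "v \<in> words Vs" "z \<in> carrier (tensor K Ws)" for u v z
    using that(3)
    by (induction rule: tensor_induct)
      (use that m mm in \<open>simp_all add: lin tensor_elem_pure tensor_elem_pure[OF mm(1), simplified]\<close>)
  have 2: "?P (pure_tensor K Us u) y z"
    if "u \<in> words Us" "y \<in> carrier (tensor K Vs)" "z \<in> carrier (tensor K Ws)" for u y z
    using that(2)
    by (induction rule: tensor_induct) (use that m mm in \<open>simp_all add: lin 1\<close>)
  show ?thesis
    using assms(4)
    by (induction rule: tensor_induct) (use assms mm in \<open>simp_all add: lin 2\<close>)
qed

section \<open>The strict monoidal category of tensor products\<close>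

definition arr :: "('k, 'a) tmap \<Rightarrow> bool" where
  "arr f \<longleftrightarrow> f \<in> linear_maps K (src f) (tgt f) \<and> modules (src f) \<and> modules (tgt f)"

abbreviation tens :: "('k, 'a) tmap \<Rightarrow> ('k, 'a) tmap \<Rightarrow> ('k, 'a) tmap" (infixr "\<boxtimes>" 75) where
  "f \<boxtimes> g \<equiv> f \<boxtimes>\<^bsub>K\<^esub> g"

abbreviation comp :: "('k, 'a) tmap \<Rightarrow> ('k, 'a) tmap \<Rightarrow> ('k, 'a) tmap" (infixr "\<bullet>" 70) where
  "g \<bullet> f \<equiv> g \<bullet>\<^bsub>K\<^esub> f"

abbreviation idm :: "('k, 'a) module list \<Rightarrow> ('k, 'a) tmap" where
  "idm U \<equiv> id_map K U"

lemma arrI: "f \<in> linear_maps K U V \<Longrightarrow> modules U \<Longrightarrow> modules V \<Longrightarrow> arr f"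
  by (simp add: arr_def linear_mapsD(1,2))

lemma arr_linear: "arr f \<Longrightarrow> f \<in> linear_maps K (src f) (tgt f)"
  by (simp add: arr_def)

lemma arr_modules [simp]: "arr f \<Longrightarrow> modules (src f)" "arr f \<Longrightarrow> modules (tgt f)"
  by (simp_all add: arr_def)

lemma arr_closed:
  "arr f \<Longrightarrow> src f = U \<Longrightarrow> tgt f = V \<Longrightarrow> x \<in> carrier (tensor K U) \<Longrightarrow> fn f x \<in> carrier (tensor K V)"
  by (rule linear_mapsD(3)[of f U V]) (use arr_linear in auto)

lemma arr_eqI:
  assumes "arr f" "arr g" "src f = src g" "tgt f = tgt g"
    and "\<And>x. x \<in> carrier (tensor K (src f)) \<Longrightarrow> fn f x = fn g x"
  shows "f = g"
  by (rule linear_maps_eqI[of f "src f" "tgt f" g])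
    (use assms arr_linear[OF assms(1)] arr_linear[OF assms(2)] in simp_all)

lemma arr_eq_iff:
  assumes "arr f" "arr g" "src f = U" "src g = U" "tgt f = tgt g"
  shows "f = g \<longleftrightarrow> (\<forall>x\<in>carrier (tensor K U). fn f x = fn g x)"
  using assms arr_eqI[of f g] by auto

text \<open>Every word over \<open>U @ V\<close> splits, so the products of pure tensors already
  span. Testing on general elements \<open>x\<close>, \<open>y\<close> lets \<open>fn_tens\<close>
  apply directly.\<close>

lemma arr_eqI_append:
  assumes "arr f" "arr g" "src f = U @ V" "src g = U @ V" "tgt f = tgt g"
    and eq: "\<And>x y. x \<in> carrier (tensor K U) \<Longrightarrow> y \<in> carrier (tensor K V) \<Longrightarrow>
      fn f (tensor_elem K U V x y) = fn g (tensor_elem K U V x y)"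
  shows "f = g"
proof (rule linear_maps_eqI[of f "U @ V" "tgt f" g])
  have m: "modules U" "modules V"
    using arr_modules(1)[OF assms(1)] assms(3) by simp_all
  show "fn f (pure_tensor K (U @ V) w) = fn g (pure_tensor K (U @ V) w)" if "w \<in> words (U @ V)" for w
    using that by (elim words_appendE) (use eq m in \<open>simp flip: tensor_elem_pure\<close>)
qed (use assms(3-5) arr_linear[OF assms(1)] arr_linear[OF assms(2)] in simp_all)

lemma src_comp [simp]: "src (g \<bullet> f) = src f"
  and tgt_comp [simp]: "tgt (g \<bullet> f) = tgt g"
  by (simp_all add: comp_map_def)

lemma fn_comp: "src f = U \<Longrightarrow> x \<in> carrier (tensor K U) \<Longrightarrow> fn (g \<bullet> f) x = fn g (fn f x)"
  by (auto simp: comp_map_def compose_def)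

lemma arr_comp [simp]:
  assumes "arr g" "arr f" "tgt f = src g"
  shows "arr (g \<bullet> f)"
proof (rule arrI)
  note D = linear_mapsD(3,5,6)[OF arr_linear[OF assms(1)]] linear_mapsD(3,5,6)[OF arr_linear[OF assms(2)]]
  interpret U: module K "tensor K (src f)" by (rule tensor_module)
  show "g \<bullet> f \<in> linear_maps K (src f) (tgt g)"
    using D assms(3) by (auto simp: linear_maps_def comp_map_def compose_def)
qed (use assms in simp_all)

lemma comp_assoc:
  assumes "arr f" "tgt f = src g"
  shows "(h \<bullet> g) \<bullet> f = h \<bullet> g \<bullet> f"
  using compose_assoc[of "fn f" "carrier (tensor K (src f))" "carrier (tensor K (src g))" "fn h" "fn g"]
    arr_closed[OF assms(1) HOL.refl HOL.refl] assms(2)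
  by (auto simp: comp_map_def)

lemma src_idm [simp]: "src (idm U) = U"
  and tgt_idm [simp]: "tgt (idm U) = U"
  by (simp_all add: id_map_def)

lemma fn_idm [simp]: "x \<in> carrier (tensor K U) \<Longrightarrow> fn (idm U) x = x"
  by (simp add: id_map_def)

lemma arr_idm [simp]: "modules U \<Longrightarrow> arr (idm U)"
proof (rule arrI)
  interpret U: module K "tensor K U" by (rule tensor_module)
  show "idm U \<in> linear_maps K U U"
    by (auto simp: linear_maps_def id_map_def)
qed auto

lemma comp_idm_right [simp]: "arr f \<Longrightarrow> src f = U \<Longrightarrow> f \<bullet> idm U = f"
  by (rule arr_eqI) (auto simp: fn_comp)

lemma comp_idm_left [simp]: "arr f \<Longrightarrow> tgt f = U \<Longrightarrow> idm U \<bullet> f = f"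
  by (rule arr_eqI) (auto simp: fn_comp arr_closed)

lemma tens:
  assumes f: "arr f" and g: "arr g"
  shows arr_tens [simp]: "arr (f \<boxtimes> g)"
    and src_tens [simp]: "src (f \<boxtimes> g) = src f @ src g"
    and tgt_tens [simp]: "tgt (f \<boxtimes> g) = tgt f @ tgt g"
    and fn_tens: "x \<in> carrier (tensor K (src f)) \<Longrightarrow> y \<in> carrier (tensor K (src g)) \<Longrightarrow>
      fn (f \<boxtimes> g) (tensor_elem K (src f) (src g) x y) = tensor_elem K (tgt f) (tgt g) (fn f x) (fn g y)"
proof -
  let ?S = "tensor K (src f @ src g)" and ?T = "tensor K (tgt f @ tgt g)"
  note m = arr_modules[OF f] arr_modules[OF g]
  note F = linear_mapsD(3,5,6)[OF arr_linear[OF f]]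
    and G = linear_mapsD(3,5,6)[OF arr_linear[OF g]]
  note P = multilinearD[OF pure_tensor_multilinear[OF m(1)]]
    and Q = multilinearD[OF pure_tensor_multilinear[OF m(3)]]
  define \<phi> where "\<phi> w = tensor_elem K (tgt f) (tgt g)
            (fn f (pure_tensor K (src f) (take (length (src f)) w)))
            (fn g (pure_tensor K (src g) (drop (length (src f)) w)))" for w
  have \<phi>: "multilinear (src f @ src g) ?T \<phi>"
    unfolding multilinear_def
  proof (intro conjI ballI allI impI)
    show "\<phi> \<in> words (src f @ src g) \<rightarrow> carrier ?T"
      by (auto simp: \<phi>_def words_take_drop F(1) G(1) m)
    fix w i r x y
    assume w: "w \<in> words (src f @ src g)" and i: "i < length (src f @ src g)"
      and x: "x \<in> carrier ((src f @ src g) ! i)"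
    note wtd = words_take_drop[OF w]
    note lin = tensor_elem_linear[OF m(2,4)]
    \<comment> \<open>Position \<open>i\<close> lies in the block of \<open>f\<close> or, shifted by
      its length, in the block of \<open>g\<close>. Only one of the two tensor factors of \<phi>
      changes, so linearity of that map and bilinearity of \<open>tensor_elem\<close>
      suffice.\<close>
    consider (l) "i < length (src f)" | (r) j where "i = length (src f) + j" "j < length (src g)"
      using i by (metis add_diff_inverse_nat length_append nat_add_left_cancel_less)
    then have "(y \<in> carrier ((src f @ src g) ! i) \<longrightarrow> \<phi> (w[i := x \<oplus>\<^bsub>(src f @ src g) ! i\<^esub> y]) =
        \<phi> (w[i := x]) \<oplus>\<^bsub>?T\<^esub> \<phi> (w[i := y])) \<and>
        (r \<in> carrier K \<longrightarrow> \<phi> (w[i := r \<odot>\<^bsub>(src f @ src g) ! i\<^esub> x]) = r \<odot>\<^bsub>?T\<^esub> \<phi> (w[i := x]))"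
    proof cases
      case l
      interpret M: module K "src f ! i" using l m(1) by (simp add: modules_nth)
      show ?thesis
        using l x wtd m
        by (simp add: \<phi>_def take_update_swap nth_append P F G words_update lin)
    next
      case (r j)
      interpret M: module K "src g ! j" using r m(3) by (simp add: modules_nth)
      show ?thesis
        using r x wtd m
        by (simp add: \<phi>_def drop_update_swap nth_append Q F G words_update lin)
    qed
    then show "y \<in> carrier ((src f @ src g) ! i) \<Longrightarrow> \<phi> (w[i := x \<oplus>\<^bsub>(src f @ src g) ! i\<^esub> y]) =
        \<phi> (w[i := x]) \<oplus>\<^bsub>?T\<^esub> \<phi> (w[i := y])"
      and "r \<in> carrier K \<Longrightarrow> \<phi> (w[i := r \<odot>\<^bsub>(src f @ src g) ! i\<^esub> x]) = r \<odot>\<^bsub>?T\<^esub> \<phi> (w[i := x])"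
      by simp_all
  qed
  have mS: "modules (src f @ src g)" using m by simp
  note ext = linear_extension[OF mS \<phi>]
  have eq: "f \<boxtimes> g = linear_extension K (src f @ src g) (tgt f @ tgt g) \<phi>"
    by (simp add: tensor_map_def \<phi>_def[abs_def])
  show "src (f \<boxtimes> g) = src f @ src g" "tgt (f \<boxtimes> g) = tgt f @ tgt g" "arr (f \<boxtimes> g)"
    unfolding eq using linear_mapsD(1,2)[OF ext(1)] arrI[OF ext(1)] m by simp_all
  note E = linear_mapsD(3,5,6)[OF ext(1), folded eq]
  note lin = tensor_elem_linear[OF m(2,4)] tensor_elem_linear[OF m(1,3)] E F G
    linear_maps_zero[OF arr_linear[OF f]] linear_maps_zero[OF arr_linear[OF g]]
    linear_maps_zero[OF ext(1), folded eq] m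
  let ?P = "\<lambda>x y. fn (f \<boxtimes> g) (tensor_elem K (src f) (src g) x y) =
    tensor_elem K (tgt f) (tgt g) (fn f x) (fn g y)"
  interpret U: module K "tensor K (src f)" by (rule tensor_module)
  interpret V: module K "tensor K (src g)" by (rule tensor_module)
  have 1: "?P (pure_tensor K (src f) v) (pure_tensor K (src g) w)"
    if "v \<in> words (src f)" "w \<in> words (src g)" for v w
    using that m ext(2)[of "v @ w"]
    by (simp add: tensor_elem_pure \<phi>_def words_length flip: eq)
  have 2: "?P (pure_tensor K (src f) v) y"
    if "v \<in> words (src f)" "y \<in> carrier (tensor K (src g))" for v y
    using that(2) by (induction rule: tensor_induct) (use that(1) in \<open>simp_all add: lin 1\<close>)
  show "?P x y" if "x \<in> carrier (tensor K (src f))" "y \<in> carrier (tensor K (src g))"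
    using that(1) by (induction rule: tensor_induct) (use that(2) in \<open>simp_all add: lin 2\<close>)
qed

lemma fn_tens':
  assumes "arr f" "arr g" "src f = U" "src g = V"
    "x \<in> carrier (tensor K U)" "y \<in> carrier (tensor K V)"
  shows "fn (f \<boxtimes> g) (tensor_elem K U V x y) = tensor_elem K (tgt f) (tgt g) (fn f x) (fn g y)"
  using fn_tens[OF assms(1,2)] assms by simp

lemma interchange:
  assumes "arr f" "arr g" "arr f'" "arr g'" "tgt f = src g" "tgt f' = src g'"
  shows "(g \<boxtimes> g') \<bullet> (f \<boxtimes> f') = (g \<bullet> f) \<boxtimes> (g' \<bullet> f')"
  by (rule arr_eqI_append[of _ _ "src f" "src f'"])
    (use assms in \<open>simp_all add: fn_comp fn_tens' arr_closed\<close>)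

lemma tens_idm: "modules U \<Longrightarrow> modules V \<Longrightarrow> idm U \<boxtimes> idm V = idm (U @ V)"
  by (rule arr_eqI_append[of _ _ U V]) (simp_all add: fn_tens')

text \<open>Source and target of both sides are literally the same lists. The equation is tested on
  a word cut into three pieces, with \<open>tensor_elem_assoc\<close> used once before the maps are
  applied and once after.\<close>

lemma tens_assoc:
  assumes "arr f" "arr g" "arr h"
  shows "(f \<boxtimes> g) \<boxtimes> h = f \<boxtimes> g \<boxtimes> h"
proof (rule linear_maps_eqI[of _ "src f @ src g @ src h" "tgt f @ tgt g @ tgt h"])
  note m = arr_modules[OF assms(1)] arr_modules[OF assms(2)] arr_modules[OF assms(3)]
  fix w assume "w \<in> words (src f @ src g @ src h)"
  then obtain u v x where w: "w = u @ v @ x" "u \<in> words (src f)" "v \<in> words (src g)" "x \<in> words (src h)"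
    by (metis words_appendE)
  let ?p = "tensor_elem K (src f) (src g @ src h) (pure_tensor K (src f) u)
    (tensor_elem K (src g) (src h) (pure_tensor K (src g) v) (pure_tensor K (src h) x))"
  have p: "pure_tensor K (src f @ src g @ src h) w = ?p"
    using w m by (simp add: tensor_elem_pure)
  have p': "?p = tensor_elem K (src f @ src g) (src h)
      (tensor_elem K (src f) (src g) (pure_tensor K (src f) u) (pure_tensor K (src g) v)) (pure_tensor K (src h) x)"
    using w m by (simp add: tensor_elem_assoc)
  have "fn ((f \<boxtimes> g) \<boxtimes> h) ?p = tensor_elem K (tgt f @ tgt g) (tgt h)
      (tensor_elem K (tgt f) (tgt g) (fn f (pure_tensor K (src f) u)) (fn g (pure_tensor K (src g) v)))
      (fn h (pure_tensor K (src h) x))"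
    unfolding p' using w assms by (simp add: fn_tens')
  also have "\<dots> = fn (f \<boxtimes> g \<boxtimes> h) ?p"
    using w assms m by (simp add: fn_tens' tensor_elem_assoc arr_closed)
  finally show "fn ((f \<boxtimes> g) \<boxtimes> h) (pure_tensor K (src f @ src g @ src h) w) =
      fn (f \<boxtimes> g \<boxtimes> h) (pure_tensor K (src f @ src g @ src h) w)"
    by (simp only: p)
qed (use assms arr_linear[of "(f \<boxtimes> g) \<boxtimes> h"] arr_linear[of "f \<boxtimes> g \<boxtimes> h"] in simp_all)

text \<open>\<open>tensor K []\<close> is spanned by the empty pure tensor and plays the role of the
  ground ring, here as a strict unit object.\<close>

lemma tens_idm_Nil [simp]:
  assumes "arr f"
  shows "idm [] \<boxtimes> f = f" "f \<boxtimes> idm [] = f"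
proof -
  note m = arr_modules[OF assms]
  have p: "pure_tensor K [] [] \<in> carrier (tensor K [])" by simp
  have 1: "fn (idm [] \<boxtimes> f) x = fn f x" if "x \<in> carrier (tensor K (src f))" for x
    using fn_tens'[OF _ assms _ HOL.refl p that, of "idm []"] assms that m
    by (simp add: tensor_elem_Nil_left arr_closed)
  have 2: "fn (f \<boxtimes> idm []) x = fn f x" if "x \<in> carrier (tensor K (src f))" for x
    using fn_tens'[OF assms _ HOL.refl _ that p, of "idm []"] assms that m
    by (simp add: tensor_elem_Nil_right arr_closed)
  show "idm [] \<boxtimes> f = f" "f \<boxtimes> idm [] = f"
    by (rule arr_eqI; use assms in \<open>simp add: 1 2\<close>)+
qed

text \<open>Regarding the unit as a map from the empty tensor product makes the unit laws of a twisting map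
  instances of naturality.\<close>

definition point :: "('k, 'a) module list \<Rightarrow> ('k, 'a) formal_sum set \<Rightarrow> ('k, 'a) tmap" where
  "point U u = linear_extension K [] U (\<lambda>_. u)"

lemma point:
  assumes "modules U" "u \<in> carrier (tensor K U)"
  shows arr_point [simp]: "arr (point U u)"
    and src_point [simp]: "src (point U u) = []"
    and tgt_point [simp]: "tgt (point U u) = U"
    and fn_point [simp]: "fn (point U u) (pure_tensor K [] []) = u"
proof -
  have "multilinear [] (tensor K U) (\<lambda>_. u)"
    using assms(2) by (simp add: multilinear_def)
  note ext = linear_extension[OF modules_Nil this, folded point_def]
  show "arr (point U u)" "src (point U u) = []" "tgt (point U u) = U"
    using arrI[OF ext(1)] linear_mapsD(1,2)[OF ext(1)] assms by simp_all
  show "fn (point U u) (pure_tensor K [] []) = u"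
    by (rule ext) simp
qed

lemma arr_Nil_eqI:
  assumes "arr f" "arr g" "src f = []" "src g = []" "tgt f = tgt g"
    and "fn f (pure_tensor K [] []) = fn g (pure_tensor K [] [])"
  shows "f = g"
  by (rule linear_maps_eqI[of f "[]" "tgt f" g])
    (use assms arr_linear[OF assms(1)] arr_linear[OF assms(2)] in \<open>auto simp: words_def\<close>)

lemma tens_point:
  assumes "modules U" "u \<in> carrier (tensor K U)" "modules V" "v \<in> carrier (tensor K V)"
  shows "point U u \<boxtimes> point V v = point (U @ V) (tensor_elem K U V u v)"
proof (rule arr_Nil_eqI)
  have "fn (point U u \<boxtimes> point V v) (tensor_elem K [] [] (pure_tensor K [] []) (pure_tensor K [] [])) =
      tensor_elem K U V u v"
    using assms fn_tens'[of "point U u" "point V v" "[]" "[]"] by simp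
  then show "fn (point U u \<boxtimes> point V v) (pure_tensor K [] []) =
      fn (point (U @ V) (tensor_elem K U V u v)) (pure_tensor K [] [])"
    using assms by (simp add: tensor_elem_pure)
qed (use assms in simp_all)

lemma fn_tens_point:
  assumes "modules U" "u \<in> carrier (tensor K U)" "modules V" "x \<in> carrier (tensor K V)"
  shows "fn (point U u \<boxtimes> idm V) x = tensor_elem K U V u x"
    and "fn (idm V \<boxtimes> point U u) x = tensor_elem K V U x u"
proof -
  have p: "pure_tensor K [] [] \<in> carrier (tensor K [])" by simp
  show "fn (point U u \<boxtimes> idm V) x = tensor_elem K U V u x"
    using assms fn_tens'[OF _ _ _ _ p, of "point U u" "idm V" V x]
    by (simp add: tensor_elem_Nil_left)
  show "fn (idm V \<boxtimes> point U u) x = tensor_elem K V U x u"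
    using assms fn_tens'[OF _ _ _ _ _ p, of "idm V" "point U u" V x]
    by (simp add: tensor_elem_Nil_right)
qed

section \<open>Typed maps and whiskering\<close>

definition mor :: "('k, 'a) tmap \<Rightarrow> ('k, 'a) module list \<Rightarrow> ('k, 'a) module list \<Rightarrow> bool" where
  "mor f U V \<longleftrightarrow> arr f \<and> src f = U \<and> tgt f = V"

lemma mor_modules: "mor f U V \<Longrightarrow> modules U" "mor f U V \<Longrightarrow> modules V"
  by (auto simp: mor_def)

lemma mor_linear_maps: "modules U \<Longrightarrow> modules V \<Longrightarrow> mor f U V \<longleftrightarrow> f \<in> linear_maps K U V"
proof
  show "f \<in> linear_maps K U V" if "mor f U V"
    using that arr_linear[of f] by (simp add: mor_def)
qed (simp add: mor_def arrI linear_mapsD(1,2))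

lemma idm_tens_comp:
  assumes "modules U" "arr f" "arr g" "tgt f = src g"
  shows "idm U \<boxtimes> (g \<bullet> f) = (idm U \<boxtimes> g) \<bullet> (idm U \<boxtimes> f)"
  using assms by (simp add: interchange)

lemma comp_tens_idm:
  assumes "modules U" "arr f" "arr g" "tgt f = src g"
  shows "(g \<bullet> f) \<boxtimes> idm U = (g \<boxtimes> idm U) \<bullet> (f \<boxtimes> idm U)"
  using assms by (simp add: interchange)

lemma idm_tens_idm_tens:
  assumes "modules U" "modules V" "arr f"
  shows "idm U \<boxtimes> idm V \<boxtimes> f = idm (U @ V) \<boxtimes> f"
  using assms by (simp add: tens_idm flip: tens_assoc)

text \<open>A normal form: composites are nested to the right, identities are distributed over them,
  and adjacent identities are fused. It does not exchange maps acting on disjoint strands; wherever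
  such an exchange is the point of a proof, \<open>slide\<close> or \<open>interchange\<close> is
  invoked explicitly.\<close>

lemmas whisker = idm_tens_comp comp_tens_idm idm_tens_idm_tens tens_idm tens_assoc comp_assoc

lemma slide:
  assumes "arr f" "arr g" "src f = U" "tgt f = V" "src g = U'" "tgt g = V'"
  shows "(f \<boxtimes> idm V') \<bullet> (idm U \<boxtimes> g) = f \<boxtimes> g"
    and "(idm V \<boxtimes> g) \<bullet> (f \<boxtimes> idm U') = f \<boxtimes> g"
  using assms by (auto simp: interchange)

section \<open>Crossings\<close>

text \<open>Here \<open>f : U \<rightarrow> V\<close>, and \<open>a\<close>, \<open>b\<close> are the crossings of \<open>U\<close>, \<open>V\<close> with a fixed object: \<open>Z @ U \<rightarrow> U @ Z\<close> and
  \<open>Z @ V \<rightarrow> V @ Z\<close> on the left, \<open>U @ X \<rightarrow> X @ U\<close> and \<open>V @ X \<rightarrow> X @ V\<close> on the right.\<close>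

definition left_natural ::
    "('k, 'a) module list \<Rightarrow> ('k, 'a) tmap \<Rightarrow> ('k, 'a) tmap \<Rightarrow> ('k, 'a) tmap \<Rightarrow> bool" where
  "left_natural Z f a b \<longleftrightarrow> b \<bullet> (idm Z \<boxtimes> f) = (f \<boxtimes> idm Z) \<bullet> a"

definition right_natural ::
    "('k, 'a) module list \<Rightarrow> ('k, 'a) tmap \<Rightarrow> ('k, 'a) tmap \<Rightarrow> ('k, 'a) tmap \<Rightarrow> bool" where
  "right_natural X f a b \<longleftrightarrow> b \<bullet> (f \<boxtimes> idm X) = (idm X \<boxtimes> f) \<bullet> a"

text \<open>One strand coming from the left passes \<open>U\<close> by \<open>a\<close> and then
  \<open>V\<close> by \<open>b\<close>, as in a hexagon identity of a braiding. The same formula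
  describes a fixed strand passing a merged pair of algebras, which is how the \<open>T\<close> maps
  with index above \<open>j\<close> arise.\<close>

definition left_cross ::
    "('k, 'a) module list \<Rightarrow> ('k, 'a) tmap \<Rightarrow> ('k, 'a) module list \<Rightarrow> ('k, 'a) tmap \<Rightarrow> ('k, 'a) tmap" where
  "left_cross U a V b = (idm U \<boxtimes> b) \<bullet> (a \<boxtimes> idm V)"

text \<open>The mirror image: a strand coming from the right passes \<open>V\<close> by
  \<open>b\<close> first and \<open>U\<close> by \<open>a\<close> afterwards.\<close>

definition right_cross ::
    "('k, 'a) module list \<Rightarrow> ('k, 'a) tmap \<Rightarrow> ('k, 'a) module list \<Rightarrow> ('k, 'a) tmap \<Rightarrow> ('k, 'a) tmap" where
  "right_cross U a V b = (a \<boxtimes> idm V) \<bullet> (idm U \<boxtimes> b)"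

lemma left_cross_assoc:
  assumes "mor a (Z @ U) (U @ Z)" "mor b (Z @ V) (V @ Z)" "mor c (Z @ W) (W @ Z)"
  shows "left_cross (U @ V) (left_cross U a V b) W c = left_cross U a (V @ W) (left_cross V b W c)"
  using assms mor_modules[OF assms(1)] mor_modules[OF assms(2)] mor_modules[OF assms(3)]
  by (simp add: mor_def left_cross_def whisker)

lemma right_cross_assoc:
  assumes "mor a (U @ X) (X @ U)" "mor b (V @ X) (X @ V)" "mor c (W @ X) (X @ W)"
  shows "right_cross (U @ V) (right_cross U a V b) W c = right_cross U a (V @ W) (right_cross V b W c)"
  using assms mor_modules[OF assms(1)] mor_modules[OF assms(2)] mor_modules[OF assms(3)]
  by (simp add: mor_def right_cross_def whisker)

text \<open>Both sides carry the block \<open>Y @ Z\<close> past \<open>U @ V\<close> by the same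
  four crossings. They differ only in the order of \<open>a\<close> (of \<open>Y\<close> and
  \<open>U\<close>) and \<open>b'\<close> (of \<open>Z\<close> and \<open>V\<close>), which act on
  disjoint strands.\<close>

lemma right_cross_left_cross:
  assumes "mor a (Y @ U) (U @ Y)" "mor b (Y @ V) (V @ Y)" "mor a' (Z @ U) (U @ Z)" "mor b' (Z @ V) (V @ Z)"
  shows "right_cross Y (left_cross U a V b) Z (left_cross U a' V b') =
    left_cross U (right_cross Y a Z a') V (right_cross Y b Z b')"
proof -
  note m = mor_modules[OF assms(1)] mor_modules[OF assms(2)] mor_modules[OF assms(3)]
  have "(a \<boxtimes> idm (V @ Z)) \<bullet> (idm (Y @ U) \<boxtimes> b') = (idm (U @ Y) \<boxtimes> b') \<bullet> (a \<boxtimes> idm (Z @ V))"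
    using assms by (simp add: mor_def slide)
  then have "(a \<boxtimes> idm (V @ Z)) \<bullet> (idm (Y @ U) \<boxtimes> b') \<bullet> (idm Y \<boxtimes> a' \<boxtimes> idm V) =
      (idm (U @ Y) \<boxtimes> b') \<bullet> (a \<boxtimes> idm (Z @ V)) \<bullet> (idm Y \<boxtimes> a' \<boxtimes> idm V)"
    using assms m by (simp add: mor_def flip: comp_assoc)
  then show ?thesis
    using assms m by (simp add: mor_def left_cross_def right_cross_def whisker)
qed

lemma left_natural_idm: "mor a (Z @ U) (U @ Z) \<Longrightarrow> left_natural Z (idm U) a a"
  using mor_modules[of a] by (simp add: left_natural_def mor_def tens_idm)

lemma right_natural_idm: "mor a (U @ X) (X @ U) \<Longrightarrow> right_natural X (idm U) a a"
  using mor_modules[of a] by (simp add: right_natural_def mor_def tens_idm)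

lemma left_natural_comp:
  assumes "left_natural Z f a b" "left_natural Z g b c"
    and "mor f U V" "mor g V W"
    and "mor a (Z @ U) (U @ Z)" "mor b (Z @ V) (V @ Z)" "mor c (Z @ W) (W @ Z)"
  shows "left_natural Z (g \<bullet> f) a c"
proof -
  note m = mor_modules[OF assms(3)] mor_modules[OF assms(4)] mor_modules[OF assms(5)]
  note t = assms(3-7)[unfolded mor_def] m
  have "c \<bullet> (idm Z \<boxtimes> (g \<bullet> f)) = (c \<bullet> (idm Z \<boxtimes> g)) \<bullet> (idm Z \<boxtimes> f)"
    using t by (simp add: whisker)
  also have "\<dots> = (g \<boxtimes> idm Z) \<bullet> (b \<bullet> (idm Z \<boxtimes> f))"
    using t assms(2) by (simp add: left_natural_def comp_assoc)
  also have "\<dots> = ((g \<bullet> f) \<boxtimes> idm Z) \<bullet> a"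
    using t assms(1) by (simp add: left_natural_def whisker)
  finally show ?thesis by (simp add: left_natural_def)
qed

lemma right_natural_comp:
  assumes "right_natural X f a b" "right_natural X g b c"
    and "mor f U V" "mor g V W"
    and "mor a (U @ X) (X @ U)" "mor b (V @ X) (X @ V)" "mor c (W @ X) (X @ W)"
  shows "right_natural X (g \<bullet> f) a c"
proof -
  note m = mor_modules[OF assms(3)] mor_modules[OF assms(4)] mor_modules[OF assms(5)]
  note t = assms(3-7)[unfolded mor_def] m
  have "c \<bullet> ((g \<bullet> f) \<boxtimes> idm X) = (c \<bullet> (g \<boxtimes> idm X)) \<bullet> (f \<boxtimes> idm X)"
    using t by (simp add: whisker)
  also have "\<dots> = (idm X \<boxtimes> g) \<bullet> (b \<bullet> (f \<boxtimes> idm X))"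
    using t assms(2) by (simp add: right_natural_def comp_assoc)
  also have "\<dots> = (idm X \<boxtimes> (g \<bullet> f)) \<bullet> a"
    using t assms(1) by (simp add: right_natural_def whisker)
  finally show ?thesis by (simp add: right_natural_def)
qed

text \<open>The moving strand meets the two factors one after the other, so \<open>f\<close> slides
  through the first crossing and \<open>g\<close> through the second. While one of them slides, the
  interchange law takes care of the other.\<close>

lemma left_natural_tens:
  assumes "left_natural Z f a b" "left_natural Z g a' b'"
    and "mor f U V" "mor g U' V'"
    and "mor a (Z @ U) (U @ Z)" "mor b (Z @ V) (V @ Z)" "mor a' (Z @ U') (U' @ Z)" "mor b' (Z @ V') (V' @ Z)"
  shows "left_natural Z (f \<boxtimes> g) (left_cross U a U' a') (left_cross V b V' b')"
proof -
  note m = mor_modules[OF assms(3)] mor_modules[OF assms(4)] mor_modules[OF assms(5)]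
  note t = assms(3-8)[unfolded mor_def] m
  have 1: "(b \<boxtimes> idm V') \<bullet> (idm Z \<boxtimes> f \<boxtimes> g) = (f \<boxtimes> idm Z \<boxtimes> g) \<bullet> (a \<boxtimes> idm U')"
  proof -
    have "(b \<boxtimes> idm V') \<bullet> ((idm Z \<boxtimes> f) \<boxtimes> g) = ((f \<boxtimes> idm Z) \<boxtimes> g) \<bullet> (a \<boxtimes> idm U')"
      using t assms(1) by (simp add: interchange left_natural_def)
    then show ?thesis using t by (simp add: tens_assoc)
  qed
  have 2: "(idm V \<boxtimes> b') \<bullet> (f \<boxtimes> idm Z \<boxtimes> g) = (f \<boxtimes> g \<boxtimes> idm Z) \<bullet> (idm U \<boxtimes> a')"
    using t assms(2) by (simp add: interchange left_natural_def)
  have "left_cross V b V' b' \<bullet> (idm Z \<boxtimes> f \<boxtimes> g) = ((idm V \<boxtimes> b') \<bullet> (f \<boxtimes> idm Z \<boxtimes> g)) \<bullet> (a \<boxtimes> idm U')"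
    using t by (simp add: left_cross_def comp_assoc 1)
  also have "\<dots> = ((f \<boxtimes> g) \<boxtimes> idm Z) \<bullet> left_cross U a U' a'"
    using t by (simp add: 2 left_cross_def comp_assoc tens_assoc)
  finally show ?thesis by (simp add: left_natural_def)
qed

lemma right_natural_tens:
  assumes "right_natural X f a b" "right_natural X g a' b'"
    and "mor f U V" "mor g U' V'"
    and "mor a (U @ X) (X @ U)" "mor b (V @ X) (X @ V)" "mor a' (U' @ X) (X @ U')" "mor b' (V' @ X) (X @ V')"
  shows "right_natural X (f \<boxtimes> g) (right_cross U a U' a') (right_cross V b V' b')"
proof -
  note m = mor_modules[OF assms(3)] mor_modules[OF assms(4)] mor_modules[OF assms(5)]
  note t = assms(3-8)[unfolded mor_def] m
  have 1: "(idm V \<boxtimes> b') \<bullet> (f \<boxtimes> g \<boxtimes> idm X) = (f \<boxtimes> idm X \<boxtimes> g) \<bullet> (idm U \<boxtimes> a')"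
    using t assms(2) by (simp add: interchange right_natural_def)
  have 2: "(b \<boxtimes> idm V') \<bullet> (f \<boxtimes> idm X \<boxtimes> g) = (idm X \<boxtimes> f \<boxtimes> g) \<bullet> (a \<boxtimes> idm U')"
  proof -
    have "(b \<boxtimes> idm V') \<bullet> ((f \<boxtimes> idm X) \<boxtimes> g) = ((idm X \<boxtimes> f) \<boxtimes> g) \<bullet> (a \<boxtimes> idm U')"
      using t assms(1) by (simp add: interchange right_natural_def)
    then show ?thesis using t by (simp add: tens_assoc)
  qed
  have "right_cross V b V' b' \<bullet> ((f \<boxtimes> g) \<boxtimes> idm X) = ((b \<boxtimes> idm V') \<bullet> (f \<boxtimes> idm X \<boxtimes> g)) \<bullet> (idm U \<boxtimes> a')"
    using t by (simp add: right_cross_def comp_assoc tens_assoc 1)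
  also have "\<dots> = (idm X \<boxtimes> f \<boxtimes> g) \<bullet> right_cross U a U' a'"
    using t by (simp add: 2 right_cross_def comp_assoc)
  finally show ?thesis by (simp add: right_natural_def)
qed

text \<open>Here the map stays the same and the object passing it is a block \<open>Y @ Z\<close>:
  \<open>f\<close> slides through the crossings with \<open>Z\<close>, then through those with
  \<open>Y\<close>. It is used for facts about a third algebra or a pair of algebras facing a merged
  one.\<close>

lemma left_natural_append:
  assumes "left_natural Y f a b" "left_natural Z f a' b'"
    and "mor f U V"
    and "mor a (Y @ U) (U @ Y)" "mor b (Y @ V) (V @ Y)" "mor a' (Z @ U) (U @ Z)" "mor b' (Z @ V) (V @ Z)"
  shows "left_natural (Y @ Z) f (right_cross Y a Z a') (right_cross Y b Z b')"
proof -
  note m = mor_modules[OF assms(3)] mor_modules[OF assms(4)] mor_modules[OF assms(6)]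
  note t = assms(3-7)[unfolded mor_def] m
  have "right_cross Y b Z b' \<bullet> (idm (Y @ Z) \<boxtimes> f) = (b \<boxtimes> idm Z) \<bullet> (idm Y \<boxtimes> (b' \<bullet> (idm Z \<boxtimes> f)))"
    using t by (simp add: right_cross_def whisker)
  also have "\<dots> = ((b \<bullet> (idm Y \<boxtimes> f)) \<boxtimes> idm Z) \<bullet> (idm Y \<boxtimes> a')"
    using t assms(2) by (simp add: left_natural_def whisker)
  also have "\<dots> = (f \<boxtimes> idm (Y @ Z)) \<bullet> right_cross Y a Z a'"
    using t assms(1) by (simp add: left_natural_def right_cross_def whisker)
  finally show ?thesis by (simp add: left_natural_def)
qed

lemma right_natural_append:
  assumes "right_natural X f a b" "right_natural Y f a' b'"
    and "mor f U V"
    and "mor a (U @ X) (X @ U)" "mor b (V @ X) (X @ V)" "mor a' (U @ Y) (Y @ U)" "mor b' (V @ Y) (Y @ V)"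
  shows "right_natural (X @ Y) f (left_cross X a Y a') (left_cross X b Y b')"
proof -
  note m = mor_modules[OF assms(3)] mor_modules[OF assms(4)] mor_modules[OF assms(6)]
  note t = assms(3-7)[unfolded mor_def] m
  have "left_cross X b Y b' \<bullet> (f \<boxtimes> idm (X @ Y)) = (idm X \<boxtimes> b') \<bullet> ((b \<bullet> (f \<boxtimes> idm X)) \<boxtimes> idm Y)"
    using t by (simp add: left_cross_def whisker)
  also have "\<dots> = (idm X \<boxtimes> (b' \<bullet> (f \<boxtimes> idm Y))) \<bullet> (a \<boxtimes> idm Y)"
    using t assms(1) by (simp add: right_natural_def whisker)
  also have "\<dots> = (idm (X @ Y) \<boxtimes> f) \<bullet> left_cross X a Y a'"
    using t assms(2) by (simp add: right_natural_def left_cross_def whisker)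
  finally show ?thesis by (simp add: right_natural_def)
qed

section \<open>Twisted products of algebras\<close>

abbreviation eta :: "('k, 'a) talgebra \<Rightarrow> ('k, 'a) tmap" where
  "eta A \<equiv> point (space A) (unit A)"

text \<open>\<open>is_talgebra\<close> does not say that the factors of \<open>space A\<close> are
  modules, while the monoidal laws above are proved for lists of modules.\<close>

definition tensor_algebra :: "('k, 'a) talgebra \<Rightarrow> bool" where
  "tensor_algebra A \<longleftrightarrow> modules (space A) \<and> is_talgebra K A"

text \<open>With the unit as an arrow \<open>eta A\<close>, the unit laws become equations between
  composites and can be treated by the same rewriting as associativity.\<close>

lemma tensor_algebra_iff:
  "tensor_algebra A \<longleftrightarrow> modules (space A) \<and> unit A \<in> carrier (tensor K (space A)) \<and>
    mor (mu A) (space A @ space A) (space A) \<and>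
    mu A \<bullet> (mu A \<boxtimes> ident K A) = mu A \<bullet> (ident K A \<boxtimes> mu A) \<and>
    mu A \<bullet> (eta A \<boxtimes> ident K A) = ident K A \<and> mu A \<bullet> (ident K A \<boxtimes> eta A) = ident K A"
proof (cases "modules (space A) \<and> unit A \<in> carrier (tensor K (space A)) \<and>
    mor (mu A) (space A @ space A) (space A)")
  case True
  then have m: "modules (space A)" and u: "unit A \<in> carrier (tensor K (space A))"
    and mu: "arr (mu A)" "src (mu A) = space A @ space A" "tgt (mu A) = space A"
    by (simp_all add: mor_def)
  have "fn (mu A \<bullet> (eta A \<boxtimes> ident K A)) x = fn (mu A) (tensor_elem K (space A) (space A) (unit A) x)"
    "fn (mu A \<bullet> (ident K A \<boxtimes> eta A)) x = fn (mu A) (tensor_elem K (space A) (space A) x (unit A))"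
    if "x \<in> carrier (tensor K (space A))" for x
    using that m u by (simp_all add: fn_comp fn_tens_point)
  then have "mu A \<bullet> (eta A \<boxtimes> ident K A) = ident K A \<longleftrightarrow>
      (\<forall>x\<in>carrier (tensor K (space A)). fn (mu A) (tensor_elem K (space A) (space A) (unit A) x) = x)"
    "mu A \<bullet> (ident K A \<boxtimes> eta A) = ident K A \<longleftrightarrow>
      (\<forall>x\<in>carrier (tensor K (space A)). fn (mu A) (tensor_elem K (space A) (space A) x (unit A)) = x)"
    using m u mu by (simp_all add: arr_eq_iff[of _ _ "space A"])
  with True show ?thesis
    using mor_linear_maps[of "space A @ space A" "space A" "mu A"]
    by (auto simp: tensor_algebra_def is_talgebra_def)
next
  case False
  then show ?thesis
    using mor_linear_maps[of "space A @ space A" "space A" "mu A"]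
    by (auto simp: tensor_algebra_def is_talgebra_def)
qed

lemma tensor_algebraD:
  assumes "tensor_algebra A"
  shows "modules (space A)" "unit A \<in> carrier (tensor K (space A))"
    "mor (mu A) (space A @ space A) (space A)" "mor (eta A) [] (space A)"
    "mu A \<bullet> (mu A \<boxtimes> ident K A) = mu A \<bullet> (ident K A \<boxtimes> mu A)"
    "mu A \<bullet> (eta A \<boxtimes> ident K A) = ident K A" "mu A \<bullet> (ident K A \<boxtimes> eta A) = ident K A"
  using assms by (auto simp: tensor_algebra_iff mor_def)

text \<open>The crossing of the empty tensor product with an object is the identity of that object;
  hence the identities as source crossings for the two units.\<close>

definition twist :: "('k, 'a) talgebra \<Rightarrow> ('k, 'a) talgebra \<Rightarrow> ('k, 'a) tmap \<Rightarrow> bool" where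
  "twist X Y R \<longleftrightarrow> mor R (space Y @ space X) (space X @ space Y) \<and>
     left_natural (space Y) (mu X) (left_cross (space X) R (space X) R) R \<and>
     right_natural (space X) (mu Y) (right_cross (space Y) R (space Y) R) R \<and>
     left_natural (space Y) (eta X) (ident K Y) R \<and>
     right_natural (space X) (eta Y) (ident K X) R"

lemma twistD:
  assumes "twist X Y R"
  shows "mor R (space Y @ space X) (space X @ space Y)"
    "left_natural (space Y) (mu X) (left_cross (space X) R (space X) R) R"
    "right_natural (space X) (mu Y) (right_cross (space Y) R (space Y) R) R"
    "left_natural (space Y) (eta X) (ident K Y) R"
    "right_natural (space X) (eta Y) (ident K X) R"
  using assms by (simp_all add: twist_def)

lemma twist_iff:
  assumes X: "tensor_algebra X" and Y: "tensor_algebra Y"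
  shows "twist X Y R \<longleftrightarrow> unital_twisting_map K X Y R"
proof (cases "mor R (space Y @ space X) (space X @ space Y)")
  case True
  note DX = tensor_algebraD[OF X] and DY = tensor_algebraD[OF Y]
  have R: "arr R" "src R = space Y @ space X" "tgt R = space X @ space Y"
    using True by (simp_all add: mor_def)
  have "fn (R \<bullet> (eta Y \<boxtimes> ident K X)) x = fn R (tensor_elem K (space Y) (space X) (unit Y) x)"
    "fn ((ident K X \<boxtimes> eta Y) \<bullet> ident K X) x = tensor_elem K (space X) (space Y) x (unit Y)"
    if "x \<in> carrier (tensor K (space X))" for x
    using that DX DY by (simp_all add: fn_comp fn_tens_point)
  then have 1: "right_natural (space X) (eta Y) (ident K X) R \<longleftrightarrow>
      (\<forall>x\<in>carrier (tensor K (space X)). fn R (tensor_elem K (space Y) (space X) (unit Y) x) =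
        tensor_elem K (space X) (space Y) x (unit Y))"
    using R DX(1,2) DY(1,2) by (simp add: right_natural_def arr_eq_iff[of _ _ "space X"])
  have "fn (R \<bullet> (ident K Y \<boxtimes> eta X)) x = fn R (tensor_elem K (space Y) (space X) x (unit X))"
    "fn ((eta X \<boxtimes> ident K Y) \<bullet> ident K Y) x = tensor_elem K (space X) (space Y) (unit X) x"
    if "x \<in> carrier (tensor K (space Y))" for x
    using that DX DY by (simp_all add: fn_comp fn_tens_point)
  then have 2: "left_natural (space Y) (eta X) (ident K Y) R \<longleftrightarrow>
      (\<forall>x\<in>carrier (tensor K (space Y)). fn R (tensor_elem K (space Y) (space X) x (unit X)) =
        tensor_elem K (space X) (space Y) (unit X) x)"
    using R DX(1,2) DY(1,2) by (simp add: left_natural_def arr_eq_iff[of _ _ "space Y"])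
  show ?thesis
    unfolding twist_def unital_twisting_map_def twisting_map_def 1 2
    using True mor_linear_maps[of "space Y @ space X" "space X @ space Y" R] DX(1) DY(1)
    by (auto simp: left_natural_def right_natural_def left_cross_def right_cross_def)
next
  case False
  then show ?thesis
    using mor_linear_maps[of "space Y @ space X" "space X @ space Y" R] tensor_algebraD(1)[OF X]
      tensor_algebraD(1)[OF Y]
    by (simp add: twist_def unital_twisting_map_def twisting_map_def)
qed

lemma twist_twisting_map:
  "tensor_algebra X \<Longrightarrow> tensor_algebra Y \<Longrightarrow> twist X Y R \<Longrightarrow> twisting_map K X Y R"
  by (simp add: twist_iff unital_twisting_map_def)

lemma compatible_iff_left_natural:
  assumes "mor Rxy (space Y @ space X) (space X @ space Y)"
    "mor Ryz (space Z @ space Y) (space Y @ space Z)"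
    "mor Rxz (space Z @ space X) (space X @ space Z)"
  shows "compatible K X Y Z Rxy Ryz Rxz \<longleftrightarrow>
    left_natural (space Z) Rxy (left_cross (space Y) Ryz (space X) Rxz) (left_cross (space X) Rxz (space Y) Ryz)"
  using assms mor_modules[OF assms(1)] mor_modules[OF assms(2)]
  by (simp add: compatible_def left_natural_def left_cross_def mor_def comp_assoc)

lemma compatible_iff_right_natural:
  assumes "mor Rxy (space Y @ space X) (space X @ space Y)"
    "mor Ryz (space Z @ space Y) (space Y @ space Z)"
    "mor Rxz (space Z @ space X) (space X @ space Z)"
  shows "compatible K X Y Z Rxy Ryz Rxz \<longleftrightarrow>
    right_natural (space X) Ryz (right_cross (space Z) Rxz (space Y) Rxy) (right_cross (space Y) Rxy (space Z) Rxz)"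
  using assms mor_modules[OF assms(1)] mor_modules[OF assms(2)]
  by (auto simp: compatible_def right_natural_def right_cross_def mor_def comp_assoc)

lemma space_twisted_product [simp]: "space (twisted_product K A R B) = space A @ space B"
  by (simp add: twisted_product_def)

lemma eta_twisted_product:
  assumes "tensor_algebra A" "tensor_algebra B"
  shows "point (space A @ space B) (unit (twisted_product K A R B)) = eta A \<boxtimes> eta B"
  using tensor_algebraD(1,2)[OF assms(1)] tensor_algebraD(1,2)[OF assms(2)]
  by (simp add: twisted_product_def tens_point)

context
  fixes A B :: "('k, 'a) talgebra" and R :: "('k, 'a) tmap"
  assumes A: "tensor_algebra A" and B: "tensor_algebra B" and R: "twist A B R"
begin

private abbreviation (input) "a \<equiv> space A"
private abbreviation (input) "b \<equiv> space B"
private abbreviation (input) "\<mu> \<equiv> mu (twisted_product K A R B)"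

text \<open>The twisted product is associative because these two actions on it commute.\<close>

private abbreviation (input) "act_left \<equiv> (idm a \<boxtimes> mu B) \<bullet> (R \<boxtimes> idm b)"
private abbreviation (input) "act_right \<equiv> (mu A \<boxtimes> idm b) \<bullet> (idm a \<boxtimes> R)"

private lemma types:
  "modules a" "modules b" "arr (mu A)" "src (mu A) = a @ a" "tgt (mu A) = a"
  "arr (mu B)" "src (mu B) = b @ b" "tgt (mu B) = b"
  "arr R" "src R = b @ a" "tgt R = a @ b"
  "arr (eta A)" "src (eta A) = []" "tgt (eta A) = a"
  "arr (eta B)" "src (eta B) = []" "tgt (eta B) = b"
  using tensor_algebraD(1-4)[OF A] tensor_algebraD(1-4)[OF B] twistD(1)[OF R]
  by (simp_all add: mor_def)

private lemma mu_eq: "\<mu> = (mu A \<boxtimes> mu B) \<bullet> (idm a \<boxtimes> R \<boxtimes> idm b)"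
  by (simp add: twisted_product_def)

text \<open>The products \<open>mu A\<close> and \<open>mu B\<close> act on disjoint strands, so
  \<open>mu B\<close> may be performed before \<open>mu A\<close>; \<open>R\<close> followed by
  \<open>mu B\<close> is then \<open>act_left\<close>. The lemma \<open>mu_eq_right\<close> chooses
  the other order.\<close>

private lemma mu_eq_left: "\<mu> = (mu A \<boxtimes> idm b) \<bullet> (idm a \<boxtimes> act_left)"
proof -
  have "(mu A \<boxtimes> idm b) \<bullet> (idm a \<boxtimes> act_left) =
      ((mu A \<boxtimes> idm b) \<bullet> (idm (a @ a) \<boxtimes> mu B)) \<bullet> (idm a \<boxtimes> R \<boxtimes> idm b)"
    by (simp add: types whisker)
  then show ?thesis
    by (simp add: mu_eq types slide)
qed

private lemma mu_eq_right: "\<mu> = (idm a \<boxtimes> mu B) \<bullet> (act_right \<boxtimes> idm b)"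
proof -
  have "(idm a \<boxtimes> mu B) \<bullet> (act_right \<boxtimes> idm b) =
      ((idm a \<boxtimes> mu B) \<bullet> (mu A \<boxtimes> idm (b @ b))) \<bullet> (idm a \<boxtimes> R \<boxtimes> idm b)"
    by (simp add: types whisker)
  then show ?thesis
    by (simp add: mu_eq types slide)
qed

text \<open>This is the module law for the action of \<open>B\<close>: the product of
  \<open>B\<close> slides through \<open>R\<close>, is reassociated, and its inner copy is exchanged
  with the remaining crossing.\<close>

private lemma act_left_mu: "act_left \<bullet> (mu B \<boxtimes> idm (a @ b)) = act_left \<bullet> (idm b \<boxtimes> act_left)"
proof -
  have "act_left \<bullet> (mu B \<boxtimes> idm (a @ b)) = (idm a \<boxtimes> mu B) \<bullet> ((R \<bullet> (mu B \<boxtimes> idm a)) \<boxtimes> idm b)"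
    by (simp add: types whisker)
  also have "\<dots> = (idm a \<boxtimes> mu B) \<bullet> (((idm a \<boxtimes> mu B) \<bullet> (R \<boxtimes> idm b) \<bullet> (idm b \<boxtimes> R)) \<boxtimes> idm b)"
    using twistD(3)[OF R] by (simp add: right_natural_def right_cross_def)
  also have "\<dots> = (idm a \<boxtimes> (mu B \<bullet> (mu B \<boxtimes> idm b))) \<bullet> (R \<boxtimes> idm (b @ b)) \<bullet> (idm b \<boxtimes> R \<boxtimes> idm b)"
    by (simp add: types whisker)
  also have "\<dots> = (idm a \<boxtimes> mu B) \<bullet> ((idm (a @ b) \<boxtimes> mu B) \<bullet> (R \<boxtimes> idm (b @ b))) \<bullet> (idm b \<boxtimes> R \<boxtimes> idm b)"
    by (simp add: types whisker tensor_algebraD(5)[OF B])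
  also have "(idm (a @ b) \<boxtimes> mu B) \<bullet> (R \<boxtimes> idm (b @ b)) = (R \<boxtimes> idm b) \<bullet> (idm (b @ a) \<boxtimes> mu B)"
    by (simp add: types slide)
  also have "(idm a \<boxtimes> mu B) \<bullet> \<dots> \<bullet> (idm b \<boxtimes> R \<boxtimes> idm b) = act_left \<bullet> (idm b \<boxtimes> act_left)"
    by (simp add: types whisker)
  finally show ?thesis .
qed

private lemma act_right_mu: "act_right \<bullet> (idm (a @ b) \<boxtimes> mu A) = act_right \<bullet> (act_right \<boxtimes> idm a)"
proof -
  have "act_right \<bullet> (idm (a @ b) \<boxtimes> mu A) = (mu A \<boxtimes> idm b) \<bullet> (idm a \<boxtimes> (R \<bullet> (idm b \<boxtimes> mu A)))"
    by (simp add: types whisker)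
  also have "\<dots> = (mu A \<boxtimes> idm b) \<bullet> (idm a \<boxtimes> ((mu A \<boxtimes> idm b) \<bullet> (idm a \<boxtimes> R) \<bullet> (R \<boxtimes> idm a)))"
    using twistD(2)[OF R] by (simp add: left_natural_def left_cross_def)
  also have "\<dots> = ((mu A \<bullet> (idm a \<boxtimes> mu A)) \<boxtimes> idm b) \<bullet> (idm (a @ a) \<boxtimes> R) \<bullet> (idm a \<boxtimes> R \<boxtimes> idm a)"
    by (simp add: types whisker)
  also have "\<dots> = (mu A \<boxtimes> idm b) \<bullet> ((mu A \<boxtimes> idm (a @ b)) \<bullet> (idm (a @ a) \<boxtimes> R)) \<bullet> (idm a \<boxtimes> R \<boxtimes> idm a)"
    by (simp add: types whisker flip: tensor_algebraD(5)[OF A])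
  also have "(mu A \<boxtimes> idm (a @ b)) \<bullet> (idm (a @ a) \<boxtimes> R) = (idm a \<boxtimes> R) \<bullet> (mu A \<boxtimes> idm (b @ a))"
    by (simp add: types slide)
  also have "(mu A \<boxtimes> idm b) \<bullet> \<dots> \<bullet> (idm a \<boxtimes> R \<boxtimes> idm a) = act_right \<bullet> (act_right \<boxtimes> idm a)"
    by (simp add: types whisker)
  finally show ?thesis .
qed

private lemma mor_mu: "mor \<mu> (a @ b @ a @ b) (a @ b)"
  by (simp add: mor_def mu_eq types)

private lemma mu_assoc: "\<mu> \<bullet> (\<mu> \<boxtimes> idm (a @ b)) = \<mu> \<bullet> (idm (a @ b) \<boxtimes> \<mu>)"
proof -
  have t: "arr \<mu>" "src \<mu> = a @ b @ a @ b" "tgt \<mu> = a @ b"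
    using mor_mu by (simp_all add: mor_def)
  \<comment> \<open>Under the outer product, multiplying the \<open>B\<close>-factor of the left
    argument by \<open>b\<close> is the same as letting \<open>b\<close> act on the right argument.
    Fact 2 is the mirror statement for \<open>A\<close>.\<close>
  have 1: "\<mu> \<bullet> (idm a \<boxtimes> mu B \<boxtimes> idm (a @ b)) = \<mu> \<bullet> (idm (a @ b) \<boxtimes> act_left)"
  proof -
    have "\<mu> \<bullet> (idm a \<boxtimes> mu B \<boxtimes> idm (a @ b)) =
        (mu A \<boxtimes> idm b) \<bullet> (idm a \<boxtimes> (act_left \<bullet> (mu B \<boxtimes> idm (a @ b))))"
      by (simp add: mu_eq_left types whisker)
    then show ?thesis
      by (simp only: act_left_mu) (simp add: mu_eq_left types whisker)
  qed
  have 2: "\<mu> \<bullet> (idm (a @ b) \<boxtimes> mu A \<boxtimes> idm b) = \<mu> \<bullet> (act_right \<boxtimes> idm (a @ b))"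
  proof -
    have "\<mu> \<bullet> (idm (a @ b) \<boxtimes> mu A \<boxtimes> idm b) =
        (idm a \<boxtimes> mu B) \<bullet> ((act_right \<bullet> (idm (a @ b) \<boxtimes> mu A)) \<boxtimes> idm b)"
      by (simp add: mu_eq_right types whisker)
    then show ?thesis
      by (simp only: act_right_mu) (simp add: mu_eq_right types whisker)
  qed
  have "\<mu> \<bullet> (\<mu> \<boxtimes> idm (a @ b)) =
      (\<mu> \<bullet> (idm a \<boxtimes> mu B \<boxtimes> idm (a @ b))) \<bullet> (act_right \<boxtimes> idm (b @ a @ b))"
    \<comment> \<open>Only the inner product is expanded; the outer one stays folded, so that fact 1
      applies to it.\<close>
    by (subst (2) mu_eq_right) (simp add: t types whisker)
  also have "\<dots> = \<mu> \<bullet> (idm (a @ b) \<boxtimes> act_left) \<bullet> (act_right \<boxtimes> idm (b @ a @ b))"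
    unfolding 1 by (simp add: t types comp_assoc)
  \<comment> \<open>Of the six strands \<open>act_right\<close> uses the first three and
    \<open>act_left\<close> the last three, so the two actions commute.\<close>
  also have "(idm (a @ b) \<boxtimes> act_left) \<bullet> (act_right \<boxtimes> idm (b @ a @ b)) =
      (act_right \<boxtimes> idm (a @ b)) \<bullet> (idm (a @ b @ a) \<boxtimes> act_left)"
    using slide[of act_right act_left "a @ b @ a" "a @ b" "b @ a @ b" "a @ b"] by (simp add: types)
  also have "\<mu> \<bullet> \<dots> = (\<mu> \<bullet> (idm (a @ b) \<boxtimes> mu A \<boxtimes> idm b)) \<bullet> (idm (a @ b @ a) \<boxtimes> act_left)"
    unfolding 2 by (simp add: t types comp_assoc)
  also have "\<dots> = \<mu> \<bullet> (idm (a @ b) \<boxtimes> \<mu>)"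
    by (subst (3) mu_eq_left) (simp add: t types whisker)
  finally show ?thesis .
qed

private lemma mu_unit_left: "\<mu> \<bullet> ((eta A \<boxtimes> eta B) \<boxtimes> idm (a @ b)) = idm (a @ b)"
proof -
  have "(idm a \<boxtimes> R \<boxtimes> idm b) \<bullet> ((eta A \<boxtimes> eta B) \<boxtimes> idm (a @ b)) =
      (idm a \<boxtimes> R \<boxtimes> idm b) \<bullet> (eta A \<boxtimes> (eta B \<boxtimes> idm a) \<boxtimes> idm b)"
    by (simp add: types tens_assoc tens_idm)
  also have "\<dots> = eta A \<boxtimes> (R \<bullet> (eta B \<boxtimes> idm a)) \<boxtimes> idm b"
    by (simp add: types interchange)
  also have "\<dots> = (eta A \<boxtimes> idm a) \<boxtimes> (eta B \<boxtimes> idm b)"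
    using twistD(5)[OF R] by (simp add: right_natural_def types tens_assoc)
  finally have "\<mu> \<bullet> ((eta A \<boxtimes> eta B) \<boxtimes> idm (a @ b)) =
      (mu A \<boxtimes> mu B) \<bullet> ((eta A \<boxtimes> idm a) \<boxtimes> (eta B \<boxtimes> idm b))"
    by (simp add: mu_eq types comp_assoc)
  also have "\<dots> = idm (a @ b)"
    by (simp add: types interchange tensor_algebraD(6)[OF A] tensor_algebraD(6)[OF B] tens_idm)
  finally show ?thesis .
qed

private lemma mu_unit_right: "\<mu> \<bullet> (idm (a @ b) \<boxtimes> eta A \<boxtimes> eta B) = idm (a @ b)"
proof -
  have "(idm a \<boxtimes> R \<boxtimes> idm b) \<bullet> (idm (a @ b) \<boxtimes> eta A \<boxtimes> eta B) =
      (idm a \<boxtimes> R \<boxtimes> idm b) \<bullet> (idm a \<boxtimes> (idm b \<boxtimes> eta A) \<boxtimes> eta B)"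
    by (simp add: types tens_assoc flip: tens_idm)
  also have "\<dots> = idm a \<boxtimes> (R \<bullet> (idm b \<boxtimes> eta A)) \<boxtimes> eta B"
    by (simp add: types interchange)
  also have "\<dots> = (idm a \<boxtimes> eta A) \<boxtimes> (idm b \<boxtimes> eta B)"
    using twistD(4)[OF R] by (simp add: left_natural_def types tens_assoc)
  finally have "\<mu> \<bullet> (idm (a @ b) \<boxtimes> eta A \<boxtimes> eta B) =
      (mu A \<boxtimes> mu B) \<bullet> ((idm a \<boxtimes> eta A) \<boxtimes> (idm b \<boxtimes> eta B))"
    by (simp add: mu_eq types comp_assoc)
  also have "\<dots> = idm (a @ b)"
    by (simp add: types interchange tensor_algebraD(7)[OF A] tensor_algebraD(7)[OF B] tens_idm)
  finally show ?thesis .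
qed

lemma twisted_product_algebra: "tensor_algebra (twisted_product K A R B)"
  unfolding tensor_algebra_iff
  using mor_mu mu_assoc mu_unit_left mu_unit_right eta_twisted_product[OF A B, of R]
    tensor_algebraD(1,2)[OF A] tensor_algebraD(1,2)[OF B]
  by (simp add: twisted_product_def)

end

section \<open>Merging two neighbours\<close>

lemma twist_types:
  assumes "twist X Y R"
  shows "arr R" "src R = space Y @ space X" "tgt R = space X @ space Y"
    "modules (space X)" "modules (space Y)"
  using twistD(1)[OF assms] mor_modules[OF twistD(1)[OF assms]] by (simp_all add: mor_def)

lemma algebra_types:
  assumes "tensor_algebra A"
  shows "arr (mu A)" "src (mu A) = space A @ space A" "tgt (mu A) = space A"
    "arr (eta A)" "src (eta A) = []" "tgt (eta A) = space A"
  using tensor_algebraD(3,4)[OF assms] by (simp_all add: mor_def)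

lemma mu_twisted_product:
  "mu (twisted_product K A R B) = (mu A \<boxtimes> mu B) \<bullet> (ident K A \<boxtimes> R \<boxtimes> ident K B)"
  by (simp add: twisted_product_def)

context
  fixes A B :: "('k, 'a) talgebra" and R :: "('k, 'a) tmap"
  assumes A: "tensor_algebra A" and B: "tensor_algebra B" and R: "twist A B R"
begin

private lemmas t = algebra_types[OF A] algebra_types[OF B] twist_types[OF R]

text \<open>Laws about \<open>X\<close> follow because its maps slide past \<open>A\<close> and past
  \<open>B\<close>, hence past the pair. Laws about the merged algebra follow because its product
  and unit are composites of maps that slide past \<open>X\<close>.\<close>

lemma twist_right_cross:
  assumes X: "tensor_algebra X" and RA: "twist X A RA" and RB: "twist X B RB"
    and compat: "compatible K X A B RA R RB"
  shows "twist X (twisted_product K A R B) (right_cross (space A) RA (space B) RB)"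
proof -
  let ?a = "space A" and ?b = "space B" and ?x = "space X"
  let ?T = "right_cross ?a RA ?b RB"
  note ty = mor_def left_cross_def right_cross_def t algebra_types[OF X] twist_types[OF RA] twist_types[OF RB]
  \<comment> \<open>All crossings of several strands are brought to one right-nested form. Only then
    is the target crossing in \<open>n3\<close> the same term as the source crossing in
    \<open>n12\<close>, as \<open>right_natural_comp\<close> requires.\<close>
  have assoc: "right_cross (?a @ V) (right_cross ?a RA V v) W w = right_cross ?a RA (V @ W) (right_cross V v W w)"
    "right_cross (?b @ V) (right_cross ?b RB V v) W w = right_cross ?b RB (V @ W) (right_cross V v W w)"
    if "mor v (V @ ?x) (?x @ V)" "mor w (W @ ?x) (?x @ W)" for V v W w
    using that by (blast intro: right_cross_assoc twistD(1)[OF RA] twistD(1)[OF RB])+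
  have m: "mor RA (?a @ ?x) (?x @ ?a)" "mor RB (?b @ ?x) (?x @ ?b)"
    by (simp_all add: ty)
  have m2: "mor (right_cross ?a RA ?b RB) (?a @ ?b @ ?x) (?x @ ?a @ ?b)"
    "mor (right_cross ?b RB ?a RA) (?b @ ?a @ ?x) (?x @ ?b @ ?a)"
    "mor (right_cross ?b RB ?b RB) (?b @ ?b @ ?x) (?x @ ?b @ ?b)"
    by (simp_all add: ty)
  have m3: "mor (right_cross ?a RA (?b @ ?b) (right_cross ?b RB ?b RB)) (?a @ ?b @ ?b @ ?x) (?x @ ?a @ ?b @ ?b)"
    "mor (right_cross ?b RB (?a @ ?b) ?T) (?b @ ?a @ ?b @ ?x) (?x @ ?b @ ?a @ ?b)"
    by (simp_all add: ty)
  have 1: "left_natural (?a @ ?b) (mu X) (left_cross ?x ?T ?x ?T) ?T"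
    using left_natural_append[OF twistD(2)[OF RA] twistD(2)[OF RB], of "?x @ ?x" ?x]
      right_cross_left_cross[of RA ?a ?x RA ?x RB ?b RB]
    by (simp add: ty)
  have n12: "right_natural ?x (mu A \<boxtimes> mu B)
      (right_cross ?a RA (?a @ ?b @ ?b) (right_cross ?a RA (?b @ ?b) (right_cross ?b RB ?b RB))) ?T"
    using right_natural_tens[OF twistD(3)[OF RA] twistD(3)[OF RB], of "?a @ ?a" ?a "?b @ ?b" ?b]
    by (simp add: assoc m m2 m3) (simp add: ty)
  \<comment> \<open>This is where compatibility enters: the factor \<open>R\<close> in the product
    of the merged algebra slides past \<open>X\<close>.\<close>
  have "right_natural ?x R (right_cross ?b RB ?a RA) (right_cross ?a RA ?b RB)"
    using compat compatible_iff_right_natural[OF twistD(1)[OF RA] twistD(1)[OF R] twistD(1)[OF RB]] by simp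
  note n4 = right_natural_tens[OF right_natural_idm[OF m(1)]
      right_natural_tens[OF this right_natural_idm[OF m(2)], of "?b @ ?a" "?a @ ?b" ?b ?b],
      of ?a ?a "?b @ ?a @ ?b" "?a @ ?b @ ?b"]
  have n3: "right_natural ?x (idm ?a \<boxtimes> R \<boxtimes> idm ?b)
      (right_cross ?a RA (?b @ ?a @ ?b) (right_cross ?b RB (?a @ ?b) ?T))
      (right_cross ?a RA (?a @ ?b @ ?b) (right_cross ?a RA (?b @ ?b) (right_cross ?b RB ?b RB)))"
    using n4 by (simp add: assoc m m2 m3) (simp add: ty)
  have 2: "right_natural ?x (mu (twisted_product K A R B)) (right_cross (?a @ ?b) ?T (?a @ ?b) ?T) ?T"
    using right_natural_comp[OF n3 n12, of "?a @ ?b @ ?a @ ?b" "?a @ ?a @ ?b @ ?b" "?a @ ?b"]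
    by (simp add: mu_twisted_product assoc m m2 m3) (simp add: ty)
  have 3: "left_natural (?a @ ?b) (eta X) (idm (?a @ ?b)) ?T"
    using left_natural_append[OF twistD(4)[OF RA] twistD(4)[OF RB], of "[]" ?x]
    by (simp add: ty) (simp add: tens_idm t)
  have 4: "right_natural ?x (eta A \<boxtimes> eta B) (idm ?x) ?T"
    using right_natural_tens[OF twistD(5)[OF RA] twistD(5)[OF RB], of "[]" ?a "[]" ?b]
    by (simp add: ty)
  show ?thesis
    using 1 2 3 4 m2(1) by (simp add: twist_def eta_twisted_product[OF A B])
qed

text \<open>The mirror image of \<open>twist_right_cross\<close>, with \<open>X\<close> to the right
  of the merged pair and compatibility read as left naturality of \<open>R\<close>.\<close>

lemma twist_left_cross:
  assumes X: "tensor_algebra X" and RA: "twist A X RA" and RB: "twist B X RB"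
    and compat: "compatible K A B X R RB RA"
  shows "twist (twisted_product K A R B) X (left_cross (space A) RA (space B) RB)"
proof -
  let ?a = "space A" and ?b = "space B" and ?x = "space X"
  let ?T = "left_cross ?a RA ?b RB"
  note ty = mor_def left_cross_def right_cross_def t algebra_types[OF X] twist_types[OF RA] twist_types[OF RB]
  have assoc: "left_cross (?a @ V) (left_cross ?a RA V v) W w = left_cross ?a RA (V @ W) (left_cross V v W w)"
    "left_cross (?b @ V) (left_cross ?b RB V v) W w = left_cross ?b RB (V @ W) (left_cross V v W w)"
    if "mor v (?x @ V) (V @ ?x)" "mor w (?x @ W) (W @ ?x)" for V v W w
    using that by (blast intro: left_cross_assoc twistD(1)[OF RA] twistD(1)[OF RB])+
  have m: "mor RA (?x @ ?a) (?a @ ?x)" "mor RB (?x @ ?b) (?b @ ?x)"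
    by (simp_all add: ty)
  have m2: "mor (left_cross ?a RA ?b RB) (?x @ ?a @ ?b) (?a @ ?b @ ?x)"
    "mor (left_cross ?b RB ?a RA) (?x @ ?b @ ?a) (?b @ ?a @ ?x)"
    "mor (left_cross ?b RB ?b RB) (?x @ ?b @ ?b) (?b @ ?b @ ?x)"
    by (simp_all add: ty)
  have m3: "mor (left_cross ?a RA (?b @ ?b) (left_cross ?b RB ?b RB)) (?x @ ?a @ ?b @ ?b) (?a @ ?b @ ?b @ ?x)"
    "mor (left_cross ?b RB (?a @ ?b) ?T) (?x @ ?b @ ?a @ ?b) (?b @ ?a @ ?b @ ?x)"
    by (simp_all add: ty)
  have 1: "right_natural (?a @ ?b) (mu X) (right_cross ?x ?T ?x ?T) ?T"
    using right_natural_append[OF twistD(3)[OF RA] twistD(3)[OF RB], of "?x @ ?x" ?x]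
      right_cross_left_cross[of RA ?x ?a RB ?b RA ?x RB]
    by (simp add: ty)
  have n12: "left_natural ?x (mu A \<boxtimes> mu B)
      (left_cross ?a RA (?a @ ?b @ ?b) (left_cross ?a RA (?b @ ?b) (left_cross ?b RB ?b RB))) ?T"
    using left_natural_tens[OF twistD(2)[OF RA] twistD(2)[OF RB], of "?a @ ?a" ?a "?b @ ?b" ?b]
    by (simp add: assoc m m2 m3) (simp add: ty)
  have "left_natural ?x R (left_cross ?b RB ?a RA) (left_cross ?a RA ?b RB)"
    using compat compatible_iff_left_natural[OF twistD(1)[OF R] twistD(1)[OF RB] twistD(1)[OF RA]] by simp
  note n4 = left_natural_tens[OF left_natural_idm[OF m(1)]
      left_natural_tens[OF this left_natural_idm[OF m(2)], of "?b @ ?a" "?a @ ?b" ?b ?b],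
      of ?a ?a "?b @ ?a @ ?b" "?a @ ?b @ ?b"]
  have n3: "left_natural ?x (idm ?a \<boxtimes> R \<boxtimes> idm ?b)
      (left_cross ?a RA (?b @ ?a @ ?b) (left_cross ?b RB (?a @ ?b) ?T))
      (left_cross ?a RA (?a @ ?b @ ?b) (left_cross ?a RA (?b @ ?b) (left_cross ?b RB ?b RB)))"
    using n4 by (simp add: assoc m m2 m3) (simp add: ty)
  have 2: "left_natural ?x (mu (twisted_product K A R B)) (left_cross (?a @ ?b) ?T (?a @ ?b) ?T) ?T"
    using left_natural_comp[OF n3 n12, of "?a @ ?b @ ?a @ ?b" "?a @ ?a @ ?b @ ?b" "?a @ ?b"]
    by (simp add: mu_twisted_product assoc m m2 m3) (simp add: ty)
  have 3: "right_natural (?a @ ?b) (eta X) (idm (?a @ ?b)) ?T"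
    using right_natural_append[OF twistD(5)[OF RA] twistD(5)[OF RB], of "[]" ?x]
    by (simp add: ty) (simp add: tens_idm t)
  have 4: "left_natural ?x (eta A \<boxtimes> eta B) (idm ?x) ?T"
    using left_natural_tens[OF twistD(4)[OF RA] twistD(4)[OF RB], of "[]" ?a "[]" ?b]
    by (simp add: ty)
  show ?thesis
    using 1 2 3 4 m2(1) by (simp add: twist_def eta_twisted_product[OF A B])
qed

text \<open>\<open>RXY\<close> is natural for \<open>A\<close> and for \<open>B\<close>, hence for
  the block of both. The two instances of \<open>right_cross_left_cross\<close> rearrange its source
  and its target crossing into the shape that compatibility asks for.\<close>

lemma compatible_right_cross:
  assumes RXY: "twist X Y RXY"
    and RXA: "twist X A RXA" and RXB: "twist X B RXB" and RYA: "twist Y A RYA" and RYB: "twist Y B RYB"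
    and "compatible K X Y A RXY RYA RXA" "compatible K X Y B RXY RYB RXB"
  shows "compatible K X Y (twisted_product K A R B) RXY
    (right_cross (space A) RYA (space B) RYB) (right_cross (space A) RXA (space B) RXB)"
proof -
  let ?a = "space A" and ?b = "space B" and ?x = "space X" and ?y = "space Y"
  note ty = mor_def left_cross_def right_cross_def t twist_types[OF RXY]
    twist_types[OF RXA] twist_types[OF RXB] twist_types[OF RYA] twist_types[OF RYB]
  have "left_natural ?a RXY (left_cross ?y RYA ?x RXA) (left_cross ?x RXA ?y RYA)"
    "left_natural ?b RXY (left_cross ?y RYB ?x RXB) (left_cross ?x RXB ?y RYB)"
    using assms(6,7) by (simp_all add: compatible_iff_left_natural twistD(1)[OF RXY]
        twistD(1)[OF RXA] twistD(1)[OF RXB] twistD(1)[OF RYA] twistD(1)[OF RYB])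
  note n = left_natural_append[OF this, of "?y @ ?x" "?x @ ?y"]
  have "left_natural (?a @ ?b) RXY
      (left_cross ?y (right_cross ?a RYA ?b RYB) ?x (right_cross ?a RXA ?b RXB))
      (left_cross ?x (right_cross ?a RXA ?b RXB) ?y (right_cross ?a RYA ?b RYB))"
    using n right_cross_left_cross[of RYA ?a ?y RXA ?x RYB ?b RXB]
      right_cross_left_cross[of RXA ?a ?x RYA ?y RXB ?b RYB]
    by (simp add: ty)
  then show ?thesis
    by (subst compatible_iff_left_natural) (simp_all add: ty)
qed

lemma compatible_left_cross:
  assumes RYZ: "twist Y Z RYZ"
    and RAY: "twist A Y RAY" and RBY: "twist B Y RBY" and RAZ: "twist A Z RAZ" and RBZ: "twist B Z RBZ"
    and "compatible K A Y Z RAY RYZ RAZ" "compatible K B Y Z RBY RYZ RBZ"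
  shows "compatible K (twisted_product K A R B) Y Z
    (left_cross (space A) RAY (space B) RBY) RYZ (left_cross (space A) RAZ (space B) RBZ)"
proof -
  let ?a = "space A" and ?b = "space B" and ?y = "space Y" and ?z = "space Z"
  note ty = mor_def left_cross_def right_cross_def t twist_types[OF RYZ]
    twist_types[OF RAY] twist_types[OF RBY] twist_types[OF RAZ] twist_types[OF RBZ]
  have "right_natural ?a RYZ (right_cross ?z RAZ ?y RAY) (right_cross ?y RAY ?z RAZ)"
    "right_natural ?b RYZ (right_cross ?z RBZ ?y RBY) (right_cross ?y RBY ?z RBZ)"
    using assms(6,7) by (simp_all add: compatible_iff_right_natural twistD(1)[OF RYZ]
        twistD(1)[OF RAY] twistD(1)[OF RBY] twistD(1)[OF RAZ] twistD(1)[OF RBZ])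
  note n = right_natural_append[OF this, of "?z @ ?y" "?y @ ?z"]
  have "right_natural (?a @ ?b) RYZ
      (right_cross ?z (left_cross ?a RAZ ?b RBZ) ?y (left_cross ?a RAY ?b RBY))
      (right_cross ?y (left_cross ?a RAY ?b RBY) ?z (left_cross ?a RAZ ?b RBZ))"
    using n right_cross_left_cross[of RAZ ?z ?a RBZ ?b RAY ?y RBY]
      right_cross_left_cross[of RAY ?y ?a RBY ?b RAZ ?z RBZ]
    by (simp add: ty)
  then show ?thesis
    by (subst compatible_iff_right_natural) (simp_all add: ty)
qed

text \<open>With the merged algebra in the middle, the map to be slid past \<open>Z\<close> is
  itself composite: \<open>RXB\<close> on one side of \<open>A\<close>, then \<open>RXA\<close> on
  the other side of \<open>B\<close>. Each of the two factors slides past \<open>Z\<close> by its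
  own compatibility.\<close>

lemma compatible_right_cross_left_cross:
  assumes RXZ: "twist X Z RXZ"
    and RXA: "twist X A RXA" and RXB: "twist X B RXB" and RAZ: "twist A Z RAZ" and RBZ: "twist B Z RBZ"
    and "compatible K X A Z RXA RAZ RXZ" "compatible K X B Z RXB RBZ RXZ"
  shows "compatible K X (twisted_product K A R B) Z
    (right_cross (space A) RXA (space B) RXB) (left_cross (space A) RAZ (space B) RBZ) RXZ"
proof -
  let ?a = "space A" and ?b = "space B" and ?x = "space X" and ?z = "space Z"
  let ?T = "left_cross ?a RAZ ?b RBZ"
  note ty = mor_def left_cross_def right_cross_def t twist_types[OF RXZ]
    twist_types[OF RXA] twist_types[OF RXB] twist_types[OF RAZ] twist_types[OF RBZ]
  have m: "mor RAZ (?z @ ?a) (?a @ ?z)" "mor RBZ (?z @ ?b) (?b @ ?z)" "mor RXZ (?z @ ?x) (?x @ ?z)"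
    by (simp_all add: ty)
  note assoc = left_cross_assoc[OF m(1,3,2)] left_cross_assoc[OF m(3,1,2)] left_cross_assoc[OF m(1,2,3)]
  have "left_natural ?z RXA (left_cross ?a RAZ ?x RXZ) (left_cross ?x RXZ ?a RAZ)"
    "left_natural ?z RXB (left_cross ?b RBZ ?x RXZ) (left_cross ?x RXZ ?b RBZ)"
    using assms(6,7) by (simp_all add: compatible_iff_left_natural twistD(1)[OF RXZ]
        twistD(1)[OF RXA] twistD(1)[OF RXB] twistD(1)[OF RAZ] twistD(1)[OF RBZ])
  note n = left_natural_tens[OF this(1) left_natural_idm[OF m(2)], of "?a @ ?x" "?x @ ?a" ?b ?b]
    left_natural_tens[OF left_natural_idm[OF m(1)] this(2), of ?a ?a "?b @ ?x" "?x @ ?b"]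
  have n1: "left_natural ?z (RXA \<boxtimes> idm ?b) (left_cross ?a RAZ (?x @ ?b) (left_cross ?x RXZ ?b RBZ))
      (left_cross ?x RXZ (?a @ ?b) ?T)"
    using n(1) by (simp add: assoc) (simp add: ty)
  have n2: "left_natural ?z (idm ?a \<boxtimes> RXB) (left_cross (?a @ ?b) ?T ?x RXZ)
      (left_cross ?a RAZ (?x @ ?b) (left_cross ?x RXZ ?b RBZ))"
    using n(2) by (simp add: assoc) (simp add: ty)
  have "left_natural ?z (right_cross ?a RXA ?b RXB) (left_cross (?a @ ?b) ?T ?x RXZ)
      (left_cross ?x RXZ (?a @ ?b) ?T)"
    unfolding right_cross_def
    by (rule left_natural_comp[OF n2 n1, of "?a @ ?b @ ?x" "?a @ ?x @ ?b" "?x @ ?a @ ?b"])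
      (simp_all add: ty)
  then show ?thesis
    by (subst compatible_iff_left_natural) (simp_all add: ty)
qed

end

text \<open>Both products first cross \<open>C\<close> with \<open>A\<close>, then apply
  \<open>RAB\<close> and \<open>RBC\<close>, and finally multiply in all three algebras. After the
  first crossing \<open>RAB\<close> and \<open>RBC\<close> act on disjoint strands, and the two
  bracketings differ only in their order.\<close>

lemma twisted_product_assoc:
  assumes A: "tensor_algebra A" and B: "tensor_algebra B" and C: "tensor_algebra C"
    and RAB: "twist A B RAB" and RBC: "twist B C RBC" and RAC: "twist A C RAC"
  shows "twisted_product K (twisted_product K A RAB B) (left_cross (space A) RAC (space B) RBC) C =
    twisted_product K A (right_cross (space B) RAB (space C) RAC) (twisted_product K B RBC C)"
proof -
  let ?a = "space A" and ?b = "space B" and ?c = "space C"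
  let ?M = "mu A \<boxtimes> mu B \<boxtimes> mu C"
  note t = algebra_types[OF A] algebra_types[OF B] algebra_types[OF C]
    twist_types[OF RAB] twist_types[OF RBC] twist_types[OF RAC]
  have "mu (twisted_product K (twisted_product K A RAB B) (left_cross ?a RAC ?b RBC) C) =
      ?M \<bullet> (idm ?a \<boxtimes> ((RAB \<boxtimes> idm (?b @ ?c)) \<bullet> (idm (?b @ ?a) \<boxtimes> RBC)) \<boxtimes> idm ?c) \<bullet>
      (idm (?a @ ?b) \<boxtimes> RAC \<boxtimes> idm (?b @ ?c))"
  proof -
    have "((mu A \<boxtimes> mu B) \<bullet> (idm ?a \<boxtimes> RAB \<boxtimes> idm ?b)) \<boxtimes> mu C =
        ?M \<bullet> (idm ?a \<boxtimes> RAB \<boxtimes> idm (?b @ ?c @ ?c))"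
      using interchange[of "idm ?a \<boxtimes> RAB \<boxtimes> idm ?b" "mu A \<boxtimes> mu B" "idm (?c @ ?c)" "mu C"]
      by (simp add: t tens_assoc tens_idm)
    then show ?thesis
      by (simp add: mu_twisted_product left_cross_def t whisker)
  qed
  also have "(RAB \<boxtimes> idm (?b @ ?c)) \<bullet> (idm (?b @ ?a) \<boxtimes> RBC) =
      (idm (?a @ ?b) \<boxtimes> RBC) \<bullet> (RAB \<boxtimes> idm (?c @ ?b))"
    by (simp add: t slide)
  also have "?M \<bullet> (idm ?a \<boxtimes> \<dots> \<boxtimes> idm ?c) \<bullet> (idm (?a @ ?b) \<boxtimes> RAC \<boxtimes> idm (?b @ ?c)) =
      mu (twisted_product K A (right_cross ?b RAB ?c RAC) (twisted_product K B RBC C))"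
  proof -
    have "mu A \<boxtimes> ((mu B \<boxtimes> mu C) \<bullet> (idm ?b \<boxtimes> RBC \<boxtimes> idm ?c)) =
        ?M \<bullet> (idm (?a @ ?a @ ?b) \<boxtimes> RBC \<boxtimes> idm ?c)"
      using interchange[of "idm (?a @ ?a)" "mu A" "idm ?b \<boxtimes> RBC \<boxtimes> idm ?c" "mu B \<boxtimes> mu C"]
      by (simp add: t idm_tens_idm_tens)
    then show ?thesis
      by (simp add: mu_twisted_product right_cross_def t whisker)
  qed
  finally have "mu (twisted_product K (twisted_product K A RAB B) (left_cross ?a RAC ?b RBC) C) =
    mu (twisted_product K A (right_cross ?b RAB ?c RAC) (twisted_product K B RBC C))" .
  moreover have "unit (twisted_product K (twisted_product K A RAB B) (left_cross ?a RAC ?b RBC) C) =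
    unit (twisted_product K A (right_cross ?b RAB ?c RAC) (twisted_product K B RBC C))"
    using tensor_algebraD(1,2)[OF A] tensor_algebraD(1,2)[OF B] tensor_algebraD(1,2)[OF C]
    by (simp add: twisted_product_def tensor_elem_assoc)
  ultimately show ?thesis
    by (intro talgebra.equality) simp_all
qed

section \<open>Ordinary algebras\<close>

lemma words_Cons_iff: "w \<in> words (M # Ms) \<longleftrightarrow> (\<exists>x v. w = x # v \<and> x \<in> carrier M \<and> v \<in> words Ms)"
  by (auto simp: words_def list_all2_Cons2)

text \<open>All laws are tested on pure tensors, where they become the ring laws of
  \<open>A\<close>; compatibility of the ring product with scalars makes the product
  multilinear.\<close>

lemma talg_algebra:
  assumes "assoc_algebra K A"
  shows "tensor_algebra (talg K A)"
proof -
  interpret M: module K A using assms by (simp add: assoc_algebra_def)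
  interpret R: ring A using assms by (simp add: assoc_algebra_def)
  have smult: "(c \<odot>\<^bsub>A\<^esub> x) \<otimes>\<^bsub>A\<^esub> y = c \<odot>\<^bsub>A\<^esub> (x \<otimes>\<^bsub>A\<^esub> y)" "x \<otimes>\<^bsub>A\<^esub> (c \<odot>\<^bsub>A\<^esub> y) = c \<odot>\<^bsub>A\<^esub> (x \<otimes>\<^bsub>A\<^esub> y)"
    if "c \<in> carrier K" "x \<in> carrier A" "y \<in> carrier A" for c x y
    using assms that by (auto simp: assoc_algebra_def)
  have mod: "modules (A # Ms) \<longleftrightarrow> modules Ms" for Ms
    using M.module_axioms by (simp add: modules_def)
  have words1: "[x] \<in> words [A]" if "x \<in> carrier A" for x
    using that by (simp add: words_Cons_iff)
  have pure: "pure_tensor K [A] [x \<oplus>\<^bsub>A\<^esub> y] = pure_tensor K [A] [x] \<oplus>\<^bsub>tensor K [A]\<^esub> pure_tensor K [A] [y]"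
    "c \<in> carrier K \<Longrightarrow> pure_tensor K [A] [c \<odot>\<^bsub>A\<^esub> x] = c \<odot>\<^bsub>tensor K [A]\<^esub> pure_tensor K [A] [x]"
    if "x \<in> carrier A" "y \<in> carrier A" for x y c
    using that multilinearD(2,3)[OF pure_tensor_multilinear[of "[A]"], of "[x]" 0] words1
    by (simp_all add: mod)
  define \<phi> where "\<phi> w = pure_tensor K [A] [w ! 0 \<otimes>\<^bsub>A\<^esub> w ! 1]" for w
  have \<phi>: "multilinear [A, A] (tensor K [A]) \<phi>"
    by (auto simp: multilinear_def words_Cons_iff \<phi>_def less_Suc_eq R.l_distr R.r_distr pure smult words1
        nth_Cons')
  let ?mu = "mu (talg K A)"
  have mu_eq: "?mu = linear_extension K [A, A] [A] \<phi>"
    by (simp add: talg_def \<phi>_def[abs_def])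
  have "modules [A, A]" by (simp add: mod)
  note ext = linear_extension[OF this \<phi>, folded mu_eq]
  have mu: "arr ?mu" "src ?mu = [A, A]" "tgt ?mu = [A]"
    using arrI[OF ext(1)] linear_mapsD(1,2)[OF ext(1)] by (simp_all add: mod)
  have mu_pure: "fn ?mu (pure_tensor K [A, A] [x, y]) = pure_tensor K [A] [x \<otimes>\<^bsub>A\<^esub> y]"
    if "x \<in> carrier A" "y \<in> carrier A" for x y
    using that ext(2)[of "[x, y]"] by (simp add: words_Cons_iff \<phi>_def)
  let ?p = "\<lambda>x. pure_tensor K [A] [x]"
  have elem: "tensor_elem K [A] [A] (?p x) (?p y) = pure_tensor K [A, A] [x, y]"
    if "x \<in> carrier A" "y \<in> carrier A" for x y
    using that tensor_elem_pure[of "[A]" "[A]" "[x]" "[y]"] by (simp add: mod words1)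
  have elem21: "tensor_elem K [A, A] [A] (pure_tensor K [A, A] [x, y]) (?p z) = pure_tensor K [A, A, A] [x, y, z]"
    and elem12: "tensor_elem K [A] [A, A] (?p x) (pure_tensor K [A, A] [y, z]) = pure_tensor K [A, A, A] [x, y, z]"
    if "x \<in> carrier A" "y \<in> carrier A" "z \<in> carrier A" for x y z
    using that tensor_elem_pure[of "[A, A]" "[A]" "[x, y]" "[z]"]
      tensor_elem_pure[of "[A]" "[A, A]" "[x]" "[y, z]"]
    by (simp_all add: mod words_Cons_iff)
  have sp: "space (talg K A) = [A]" "unit (talg K A) = ?p \<one>\<^bsub>A\<^esub>"
    by (simp_all add: talg_def)
  have assoc: "?mu \<bullet> (?mu \<boxtimes> idm [A]) = ?mu \<bullet> (idm [A] \<boxtimes> ?mu)"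
  proof (rule linear_maps_eqI[of _ "[A, A, A]" "[A]"])
    fix w assume "w \<in> words [A, A, A]"
    then obtain x y z where w: "w = [x, y, z]" "x \<in> carrier A" "y \<in> carrier A" "z \<in> carrier A"
      by (auto simp: words_Cons_iff)
    have "fn (?mu \<bullet> (?mu \<boxtimes> idm [A])) (pure_tensor K [A, A, A] w) = ?p (x \<otimes>\<^bsub>A\<^esub> y \<otimes>\<^bsub>A\<^esub> z)"
      using w fn_tens'[of ?mu "idm [A]" "[A, A]" "[A]" "pure_tensor K [A, A] [x, y]" "?p z"]
      by (simp add: fn_comp mu mod words_Cons_iff elem21 mu_pure elem)
    moreover have "fn (?mu \<bullet> (idm [A] \<boxtimes> ?mu)) (pure_tensor K [A, A, A] w) = ?p (x \<otimes>\<^bsub>A\<^esub> (y \<otimes>\<^bsub>A\<^esub> z))"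
      using w fn_tens'[of "idm [A]" ?mu "[A]" "[A, A]" "?p x" "pure_tensor K [A, A] [y, z]"]
      by (simp add: fn_comp mu mod words_Cons_iff elem12 mu_pure elem)
    ultimately show "fn (?mu \<bullet> (?mu \<boxtimes> idm [A])) (pure_tensor K [A, A, A] w) =
        fn (?mu \<bullet> (idm [A] \<boxtimes> ?mu)) (pure_tensor K [A, A, A] w)"
      using w by (simp add: R.m_assoc)
  qed (use mu arr_linear[of "?mu \<bullet> (?mu \<boxtimes> idm [A])"] arr_linear[of "?mu \<bullet> (idm [A] \<boxtimes> ?mu)"] in
      \<open>simp_all add: mod\<close>)
  let ?eta = "point [A] (?p \<one>\<^bsub>A\<^esub>)"
  have eta: "arr ?eta" "src ?eta = []" "tgt ?eta = [A]"
    by (simp_all add: mod words1)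
  have fn_eta: "fn (?mu \<bullet> (?eta \<boxtimes> idm [A])) (pure_tensor K [A] w) = pure_tensor K [A] w"
    "fn (?mu \<bullet> (idm [A] \<boxtimes> ?eta)) (pure_tensor K [A] w) = pure_tensor K [A] w"
    if "w \<in> words [A]" for w
    using that by (auto simp: words_Cons_iff fn_comp eta mod words1 fn_tens_point elem mu_pure)
  have "?mu \<bullet> (?eta \<boxtimes> idm [A]) = idm [A]" "?mu \<bullet> (idm [A] \<boxtimes> ?eta) = idm [A]"
    by (rule linear_maps_eqI[of _ "[A]" "[A]"];
        use eta mu fn_eta arr_linear[of "idm [A]"] arr_linear[of "?mu \<bullet> (?eta \<boxtimes> idm [A])"]
          arr_linear[of "?mu \<bullet> (idm [A] \<boxtimes> ?eta)"] in \<open>simp add: mod\<close>)+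
  with assoc show ?thesis
    using mu by (simp add: tensor_algebra_iff sp mod words1 mor_def)
qed

section \<open>Iterated products\<close>

text \<open>This is the invariant of the induction. Compared with \<open>twisting_system\<close> it
  adds unitality, from which a merged algebra gets its unit laws, and so it passes to the merged
  list.\<close>

definition unital_system :: "nat \<Rightarrow> (nat \<Rightarrow> ('k, 'a) talgebra) \<Rightarrow> (nat \<Rightarrow> nat \<Rightarrow> ('k, 'a) tmap) \<Rightarrow> bool" where
  "unital_system n A R \<longleftrightarrow>
     (\<forall>i. 1 \<le> i \<and> i \<le> n \<longrightarrow> tensor_algebra (A i)) \<and>
     (\<forall>i j. 1 \<le> i \<and> i < j \<and> j \<le> n \<longrightarrow> twist (A i) (A j) (R i j)) \<and>
     (\<forall>i j k. 1 \<le> i \<and> i < j \<and> j < k \<and> k \<le> n \<longrightarrow>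
        compatible K (A i) (A j) (A k) (R i j) (R j k) (R i k))"

lemma unital_systemD:
  assumes "unital_system n A R"
  shows "1 \<le> i \<Longrightarrow> i \<le> n \<Longrightarrow> tensor_algebra (A i)"
    "1 \<le> i \<Longrightarrow> i < j \<Longrightarrow> j \<le> n \<Longrightarrow> twist (A i) (A j) (R i j)"
    "1 \<le> i \<Longrightarrow> i < j \<Longrightarrow> j < k \<Longrightarrow> k \<le> n \<Longrightarrow> compatible K (A i) (A j) (A k) (R i j) (R j k) (R i k)"
  using assms by (auto simp: unital_system_def)

lemma unital_system_twisting_system:
  assumes "unital_system n A R"
  shows "twisting_system K n A R"
  using unital_systemD[OF assms]
  by (auto simp: twisting_system_def tensor_algebra_def intro!: twist_twisting_map)

lemma merged_twist_cross:
  "i < j \<Longrightarrow> merged_twist K A R j i = right_cross (space (A (j - 1))) (R i (j - 1)) (space (A j)) (R i j)"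
  "\<not> i < j \<Longrightarrow> merged_twist K A R j i = left_cross (space (A (j - 1))) (R (j - 1) i) (space (A j)) (R j i)"
  by (simp_all add: merged_twist_def right_cross_def left_cross_def)

lemma space_merged_algebra [simp]:
  "space (merged_algebra K A R j) = space (A (j - 1)) @ space (A j)"
  by (simp add: merged_algebra_def)

context
  fixes n :: nat and A :: "nat \<Rightarrow> ('k, 'a) talgebra" and R :: "nat \<Rightarrow> nat \<Rightarrow> ('k, 'a) tmap" and j :: nat
  assumes sys: "unital_system n A R" and j: "2 \<le> j" "j \<le> n"
begin

private lemmas D = unital_systemD[OF sys]

private lemma j_facts:
  "tensor_algebra (A (j - 1))" "tensor_algebra (A j)" "twist (A (j - 1)) (A j) (R (j - 1) j)"
  using j by (auto intro!: D)

lemma merged_algebra_tensor_algebra: "tensor_algebra (merged_algebra K A R j)"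
  unfolding merged_algebra_def by (rule twisted_product_algebra) (rule j_facts)+

lemma merged_twist_right:
  "1 \<le> i \<Longrightarrow> i < j - 1 \<Longrightarrow> twist (A i) (merged_algebra K A R j) (merged_twist K A R j i)"
  using j by (auto simp: merged_algebra_def merged_twist_cross intro!: twist_right_cross j_facts D)

lemma merged_twist_left:
  "j < i \<Longrightarrow> i \<le> n \<Longrightarrow> twist (merged_algebra K A R j) (A i) (merged_twist K A R j i)"
  using j by (auto simp: merged_algebra_def merged_twist_cross intro!: twist_left_cross j_facts D)

lemma merged_compatible_right:
  "1 \<le> i \<Longrightarrow> i < k \<Longrightarrow> k < j - 1 \<Longrightarrow>
    compatible K (A i) (A k) (merged_algebra K A R j) (R i k) (merged_twist K A R j k) (merged_twist K A R j i)"
  using j by (auto simp: merged_algebra_def merged_twist_cross intro!: compatible_right_cross j_facts D)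

lemma merged_compatible_middle:
  "1 \<le> i \<Longrightarrow> i < j - 1 \<Longrightarrow> j < k \<Longrightarrow> k \<le> n \<Longrightarrow>
    compatible K (A i) (merged_algebra K A R j) (A k) (merged_twist K A R j i) (merged_twist K A R j k) (R i k)"
  using j by (auto simp: merged_algebra_def merged_twist_cross intro!: compatible_right_cross_left_cross j_facts D)

lemma merged_compatible_left:
  "j < i \<Longrightarrow> i < k \<Longrightarrow> k \<le> n \<Longrightarrow>
    compatible K (merged_algebra K A R j) (A i) (A k) (merged_twist K A R j i) (R i k) (merged_twist K A R j k)"
  using j by (auto simp: merged_algebra_def merged_twist_cross intro!: compatible_left_cross j_facts D)

text \<open>The renumbering \<open>old_index j\<close> preserves the order. A triple of positions
  either avoids \<open>j - 1\<close> and is an old triple, or has the merged algebra last, in the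
  middle or first; these are the three compatibility lemmas above.\<close>

lemma merge_unital_system: "unital_system (n - 1) (merge_algebras K A R j) (merge_twists K A R j)"
  unfolding unital_system_def
proof (intro conjI allI impI; elim conjE)
  fix p assume "1 \<le> p" "p \<le> n - 1"
  then show "tensor_algebra (merge_algebras K A R j p)"
    using j by (auto simp: merge_algebras_def old_index_def merged_algebra_tensor_algebra intro!: D)
next
  fix p q assume "1 \<le> p" "p < q" "q \<le> n - 1"
  then show "twist (merge_algebras K A R j p) (merge_algebras K A R j q) (merge_twists K A R j p q)"
    using j by (auto simp: merge_algebras_def merge_twists_def old_index_def
        intro!: D merged_twist_right merged_twist_left)
next
  fix p q r assume "1 \<le> p" "p < q" "q < r" "r \<le> n - 1"
  then show "compatible K (merge_algebras K A R j p) (merge_algebras K A R j q) (merge_algebras K A R j r)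
      (merge_twists K A R j p q) (merge_twists K A R j q r) (merge_twists K A R j p r)"
    using j by (auto simp: merge_algebras_def merge_twists_def old_index_def
        intro!: D merged_compatible_right merged_compatible_middle merged_compatible_left)
qed

end

text \<open>Families are total functions on the naturals, so two merged systems can only be expected
  to coincide at indices in range.\<close>

definition agree ::
    "nat \<Rightarrow> (nat \<Rightarrow> 'b) \<Rightarrow> (nat \<Rightarrow> nat \<Rightarrow> 'c) \<Rightarrow> (nat \<Rightarrow> 'b) \<Rightarrow> (nat \<Rightarrow> nat \<Rightarrow> 'c) \<Rightarrow> bool" where
  "agree n A R A' R' \<longleftrightarrow> (\<forall>i. 1 \<le> i \<and> i \<le> n \<longrightarrow> A i = A' i) \<and>
     (\<forall>i j. 1 \<le> i \<and> i < j \<and> j \<le> n \<longrightarrow> R i j = R' i j)"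

lemma agree_twisting_system:
  assumes "agree n A R A' R'" "twisting_system K n A R"
  shows "twisting_system K n A' R'"
proof -
  have "A i = A' i" if "1 \<le> i" "i \<le> n" for i
    using assms(1) that by (simp add: agree_def)
  moreover have "R i j = R' i j" if "1 \<le> i" "i < j" "j \<le> n" for i j
    using assms(1) that by (simp add: agree_def)
  ultimately show ?thesis
    using assms(2) by (simp add: twisting_system_def)
qed

lemma agree_merge:
  assumes "agree n A R A' R'" "2 \<le> i" "i \<le> n"
  shows "agree (n - 1) (merge_algebras K A R i) (merge_twists K A R i)
    (merge_algebras K A' R' i) (merge_twists K A' R' i)"
proof -
  have A: "A p = A' p" if "1 \<le> p" "p \<le> n" for p
    using assms(1) that by (simp add: agree_def)
  have R: "R p q = R' p q" if "1 \<le> p" "p < q" "q \<le> n" for p q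
    using assms(1) that by (simp add: agree_def)
  show ?thesis
    unfolding agree_def
  proof (intro conjI allI impI; elim conjE)
    fix p assume "1 \<le> p" "p \<le> n - 1"
    then show "merge_algebras K A R i p = merge_algebras K A' R' i p"
      using assms(2,3) by (simp add: merge_algebras_def merged_algebra_def old_index_def A R)
  next
    fix p q assume "1 \<le> p" "p < q" "q \<le> n - 1"
    then show "merge_twists K A R i p q = merge_twists K A' R' i p q"
      using assms(2,3) by (simp add: merge_twists_def merged_twist_def old_index_def A R)
  qed
qed

lemma iterated_product_agree:
  assumes "iterated_product K n A R P" "agree n A R A' R'"
  shows "iterated_product K n A' R' P"
  using assms
proof (induction arbitrary: A' R')
  case (two A R)
  moreover have "A 1 = A' 1" "A 2 = A' 2" "R 1 2 = R' 1 2"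
    using two(2) by (auto simp: agree_def)
  ultimately show ?case
    using iterated_product.two[OF agree_twisting_system[OF two(2,1)]] by simp
next
  case (merge n A R i P)
  show ?case
    by (rule iterated_product.merge[OF merge(1) agree_twisting_system[OF merge(7,2)] merge(3,4)])
      (rule merge(6)[OF agree_merge[OF merge(7,3,4)]])
qed

lemma merge_merge:
  assumes sys: "unital_system n A R" and i: "2 \<le> i" "i < n"
  shows "agree (n - 2)
    (merge_algebras K (merge_algebras K A R i) (merge_twists K A R i) i)
    (merge_twists K (merge_algebras K A R i) (merge_twists K A R i) i)
    (merge_algebras K (merge_algebras K A R (i + 1)) (merge_twists K A R (i + 1)) i)
    (merge_twists K (merge_algebras K A R (i + 1)) (merge_twists K A R (i + 1)) i)"
proof -
  note D = unital_systemD[OF sys]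
  \<comment> \<open>The three merged algebras are those at \<open>h\<close>, \<open>h + 1\<close>,
    \<open>h + 2\<close>; writing them with successors keeps truncated subtraction out of the
    rewriting.\<close>
  define h where "h = i - 1"
  have ih: "i = Suc h" "1 \<le> h" using i by (auto simp: h_def)
  have alg: "tensor_algebra (A h)" "tensor_algebra (A (Suc h))" "tensor_algebra (A (Suc (Suc h)))"
    using i ih by (auto intro!: D)
  have tw: "twist (A h) (A (Suc h)) (R h (Suc h))" "twist (A (Suc h)) (A (Suc (Suc h))) (R (Suc h) (Suc (Suc h)))"
    "twist (A h) (A (Suc (Suc h))) (R h (Suc (Suc h)))"
    using i ih by (auto intro!: D)
  have 1: "twisted_product K (merged_algebra K A R (Suc h))
      (merged_twist K A R (Suc h) (Suc (Suc h))) (A (Suc (Suc h))) =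
    twisted_product K (A h) (merged_twist K A R (Suc (Suc h)) h) (merged_algebra K A R (Suc (Suc h)))"
    using twisted_product_assoc[OF alg tw] by (simp add: merged_algebra_def merged_twist_cross)
  have 2: "left_cross (space (A h) @ space (A (Suc h)))
      (left_cross (space (A h)) (R h q) (space (A (Suc h))) (R (Suc h) q)) (space (A (Suc (Suc h)))) (R (Suc (Suc h)) q) =
    left_cross (space (A h)) (R h q) (space (A (Suc h)) @ space (A (Suc (Suc h))))
      (left_cross (space (A (Suc h))) (R (Suc h) q) (space (A (Suc (Suc h)))) (R (Suc (Suc h)) q))"
    if "Suc (Suc h) < q" "q \<le> n" for q
    by (rule left_cross_assoc[OF twistD(1)[OF D(2)] twistD(1)[OF D(2)] twistD(1)[OF D(2)]])
      (use that ih in auto)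
  have 3: "right_cross (space (A h) @ space (A (Suc h)))
      (right_cross (space (A h)) (R q h) (space (A (Suc h))) (R q (Suc h))) (space (A (Suc (Suc h)))) (R q (Suc (Suc h))) =
    right_cross (space (A h)) (R q h) (space (A (Suc h)) @ space (A (Suc (Suc h))))
      (right_cross (space (A (Suc h))) (R q (Suc h)) (space (A (Suc (Suc h)))) (R q (Suc (Suc h))))"
    if "1 \<le> q" "q < h" for q
    by (rule right_cross_assoc[OF twistD(1)[OF D(2)] twistD(1)[OF D(2)] twistD(1)[OF D(2)]])
      (use that ih i in auto)
  show ?thesis
    unfolding agree_def
  proof (intro conjI allI impI; elim conjE)
    fix p assume p: "1 \<le> p" "p \<le> n - 2"
    then show "merge_algebras K (merge_algebras K A R i) (merge_twists K A R i) i p =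
        merge_algebras K (merge_algebras K A R (i + 1)) (merge_twists K A R (i + 1)) i p"
      using 1 ih
      by (simp add: merge_algebras_def merge_twists_def old_index_def
          merged_algebra_def[of K "merge_algebras K A R (Suc h)"]
          merged_algebra_def[of K "merge_algebras K A R (Suc (Suc h))"])
  next
    fix p q assume pq: "1 \<le> p" "p < q" "q \<le> n - 2"
    consider "p = h" | "q = h" | "p \<noteq> h" "q \<noteq> h" by blast
    then show "merge_twists K (merge_algebras K A R i) (merge_twists K A R i) i p q =
        merge_twists K (merge_algebras K A R (i + 1)) (merge_twists K A R (i + 1)) i p q"
    proof cases
      case 1
      then show ?thesis
        \<comment> \<open>Two merges to the left of position \<open>q\<close> have lowered its
          original index by two.\<close>
        using 2[of "q + 2"] pq ih i
        by (simp add: merge_algebras_def merge_twists_def old_index_def merged_twist_cross)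
    next
      case 2
      then show ?thesis
        using 3[of p] pq ih i
        by (simp add: merge_algebras_def merge_twists_def old_index_def merged_twist_cross)
    next
      case 3
      then show ?thesis
        using pq ih i by (auto simp: merge_twists_def old_index_def)
    qed
  qed
qed

section \<open>Independence of the grouping\<close>

lemma iterated_product_2:
  assumes "twisting_system K 2 A R"
  shows "iterated_product K 2 A R Q \<longleftrightarrow> Q = twisted_product K (A 1) (R 1 2) (A 2)"
  using iterated_product.two[OF assms] by (auto elim: iterated_product.cases)

lemma iterated_product_step:
  assumes "3 \<le> n" "twisting_system K n A R"
  shows "iterated_product K n A R Q \<longleftrightarrow> (\<exists>i. 2 \<le> i \<and> i \<le> n \<and>
    iterated_product K (n - 1) (merge_algebras K A R i) (merge_twists K A R i) Q)"
proof
  assume "iterated_product K n A R Q"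
  then show "\<exists>i. 2 \<le> i \<and> i \<le> n \<and>
      iterated_product K (n - 1) (merge_algebras K A R i) (merge_twists K A R i) Q"
    by (cases rule: iterated_product.cases) (use assms(1) in auto)
qed (use assms in \<open>auto intro: iterated_product.merge\<close>)

text \<open>Existence and uniqueness are proved together, since each first merge is compared through
  an actual result of the common second stage. The factor list of \<open>P\<close> is included
  because the final theorem asserts what the underlying space is.\<close>

lemma iterated_product_unique:
  assumes "unital_system n A R" "2 \<le> n"
  shows "\<exists>P. space P = concat (map (\<lambda>i. space (A i)) [1..<n + 1]) \<and>
    (\<forall>Q. iterated_product K n A R Q \<longleftrightarrow> Q = P)"
  using assms
proof (induction n arbitrary: A R rule: less_induct)
  case (less n)
  note sys = less.prems(1)
  note tsys = unital_system_twisting_system[OF sys]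
  show ?case
  proof (cases "n = 2")
    case True
    moreover have "[1..<3] = [1, 2 :: nat]"
      by (simp add: upt_rec numeral_2_eq_2)
    ultimately show ?thesis
      using tsys by (intro exI[of _ "twisted_product K (A 1) (R 1 2) (A 2)"])
        (simp add: iterated_product_2)
  next
    case False
    then have n: "3 \<le> n" using less.prems(2) by simp
    let ?A = "merge_algebras K A R" and ?R = "merge_twists K A R"
    have sys': "unital_system (n - 1) (?A i) (?R i)" if "2 \<le> i" "i \<le> n" for i
      by (rule merge_unital_system[OF sys that])
    have "\<exists>P. space P = concat (map (\<lambda>p. space (?A i p)) [1..<n]) \<and>
        (\<forall>Q. iterated_product K (n - 1) (?A i) (?R i) Q \<longleftrightarrow> Q = P)" if "2 \<le> i" "i \<le> n" for i
      using less.IH[OF _ sys'[OF that]] n by simp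
    then obtain P where P: "\<And>i. 2 \<le> i \<Longrightarrow> i \<le> n \<Longrightarrow> space (P i) = concat (map (\<lambda>p. space (?A i p)) [1..<n])"
      "\<And>i Q. 2 \<le> i \<Longrightarrow> i \<le> n \<Longrightarrow> iterated_product K (n - 1) (?A i) (?R i) Q \<longleftrightarrow> Q = P i"
      by metis
    have step: "P i = P (Suc i)" if i: "2 \<le> i" "i < n" for i
    \<comment> \<open>For three factors the second stage would be a one-element list, for which
      \<open>iterated_product\<close> has no rule. The two bracketings are therefore compared
      directly.\<close>
    proof (cases "n = 3")
      case True
      then have [simp]: "i = 2" using i by simp
      have "iterated_product K 2 (?A 2) (?R 2) (P 2)" "iterated_product K 2 (?A 3) (?R 3) (P 3)"
        using P(2)[of 2] P(2)[of 3] True by simp_all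
      moreover have "twisting_system K 2 (?A 2) (?R 2)" "twisting_system K 2 (?A 3) (?R 3)"
        using sys'[of 2] sys'[of 3] True by (auto dest: unital_system_twisting_system)
      ultimately have "P 2 = merged_algebra K (?A 2) (?R 2) 2" "P 3 = merged_algebra K (?A 3) (?R 3) 2"
        by (simp_all add: iterated_product_2 merged_algebra_def)
      \<comment> \<open>Here \<open>n - 2\<close> is 1, so \<open>merge_merge\<close> compares just
        position 1, which holds the two bracketings of the triple product.\<close>
      moreover have "merge_algebras K (?A 2) (?R 2) 2 1 = merge_algebras K (?A 3) (?R 3) 2 1"
        using merge_merge[OF sys i] True by (simp add: agree_def)
      ultimately show ?thesis
        by (simp add: merge_algebras_def[of _ "?A 2"] merge_algebras_def[of _ "?A 3"])
    next
      case False
      then have n4: "3 \<le> n - 1" using n by simp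
      then have n2: "n - 2 < n" "2 \<le> n - 2" by simp_all
      have "unital_system (n - 2) (merge_algebras K (?A i) (?R i) i) (merge_twists K (?A i) (?R i) i)"
        using merge_unital_system[OF sys'[of i], of i] i by (simp add: numeral_2_eq_2)
      then obtain Q where "iterated_product K (n - 2) (merge_algebras K (?A i) (?R i) i) (merge_twists K (?A i) (?R i) i) Q"
        using less.IH[OF n2(1) _ n2(2)] by blast
      moreover note iterated_product_agree[OF this merge_merge[OF sys i]]
      \<comment> \<open>Since \<open>i\<close> is at most \<open>n - 1\<close>, a second merge at
        \<open>i\<close> is available in both systems and leads to the same \<open>Q\<close>; the
        uniqueness of their results then identifies \<open>P i\<close> with
        \<open>P (Suc i)\<close>.\<close>
      ultimately have "iterated_product K (n - 1) (?A i) (?R i) Q"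
        "iterated_product K (n - 1) (?A (i + 1)) (?R (i + 1)) Q"
        using n4 i unital_system_twisting_system[OF sys'[of i]] unital_system_twisting_system[OF sys'[of "i + 1"]]
        by (auto simp: iterated_product_step numeral_2_eq_2)
      then show ?thesis
        using P(2)[of i Q] P(2)[of "i + 1" Q] i by simp
    qed
    have P2: "P i = P 2" if "2 \<le> i" "i \<le> n" for i
      using that by (induction i rule: dec_induct) (simp_all add: step)
    have "[1..<n] = 1 # [2..<n]" "[1..<n + 1] = 1 # 2 # [3..<n + 1]"
      using n upt_conv_Cons[of 1 n] upt_conv_Cons[of 1 "n + 1"] upt_conv_Cons[of 2 "n + 1"]
      by (simp_all add: numeral_2_eq_2 numeral_3_eq_3 del: upt_Suc)
    \<comment> \<open>It suffices to compute the space for the merge at 2: position 1 holds the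
      first two algebras, and each later position holds the algebra whose index is one
      higher.\<close>
    moreover have "map (\<lambda>i. space (A i)) [3..<n + 1] = map (\<lambda>p. space (?A 2 p)) [2..<n]"
      by (rule nth_equalityI) (simp_all add: merge_algebras_def old_index_def numeral_3_eq_3 del: upt_Suc)
    ultimately have "space (P 2) = concat (map (\<lambda>i. space (A i)) [1..<n + 1])"
      using P(1)[of 2] n by (simp add: merge_algebras_def del: upt_Suc)
    moreover have "iterated_product K n A R Q \<longleftrightarrow> Q = P 2" for Q
    proof
      assume "iterated_product K n A R Q"
      then obtain i where "2 \<le> i" "i \<le> n" "iterated_product K (n - 1) (?A i) (?R i) Q"
        using iterated_product_step[OF n tsys] by blast
      then show "Q = P 2" using P(2)[of i Q] P2[of i] by simp
    next
      assume "Q = P 2"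
      then have "iterated_product K (n - 1) (?A 2) (?R 2) Q"
        using P(2)[of 2] n by simp
      then show "iterated_product K n A R Q"
        using iterated_product.merge[OF n tsys, of 2] n by simp
    qed
    ultimately show ?thesis by blast
  qed
qed

end

theorem theorem2p9:
  fixes K :: "('k, 'm) ring_scheme"
    and n :: nat
    and A :: "nat \<Rightarrow> ('k, 'a) module"
    and R :: "nat \<Rightarrow> nat \<Rightarrow> ('k, 'a) tmap"
    and B :: "nat \<Rightarrow> ('k, 'a) talgebra"
    and D :: "nat \<Rightarrow> ('k, 'a) talgebra"
    and T :: "nat \<Rightarrow> nat \<Rightarrow> ('k, 'a) tmap"
  defines "B \<equiv> \<lambda>i. talg K (A i)"
    and "D \<equiv> \<lambda>j. merged_algebra K B R j"
    and "T \<equiv> \<lambda>j i. merged_twist K B R j i"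
  assumes "cring K"
    and "3 \<le> n"
    and "\<And>i. 1 \<le> i \<Longrightarrow> i \<le> n \<Longrightarrow> assoc_algebra K (A i)"
    and "\<And>i j. 1 \<le> i \<Longrightarrow> i < j \<Longrightarrow> j \<le> n \<Longrightarrow> unital_twisting_map K (B i) (B j) (R i j)"
    and "\<And>i j k. 1 \<le> i \<Longrightarrow> i < j \<Longrightarrow> j < k \<Longrightarrow> k \<le> n \<Longrightarrow>
           compatible K (B i) (B j) (B k) (R i j) (R j k) (R i k)"
  shows "(\<forall>j i. 2 \<le> j \<and> j \<le> n \<longrightarrow>
            (1 \<le> i \<and> i < j - 1 \<longrightarrow> twisting_map K (B i) (D j) (T j i)) \<and>
            (j < i \<and> i \<le> n \<longrightarrow> twisting_map K (D j) (B i) (T j i))) \<and>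
         (\<forall>j i k. 2 \<le> j \<and> j \<le> n \<and> 1 \<le> i \<and> i < k \<and> k \<le> n \<longrightarrow>
            (k < j - 1 \<longrightarrow>
               compatible K (B i) (B k) (D j) (R i k) (T j k) (T j i)) \<and>
            (i < j - 1 \<and> j < k \<longrightarrow>
               compatible K (B i) (D j) (B k) (T j i) (T j k) (R i k)) \<and>
            (j < i \<longrightarrow>
               compatible K (D j) (B i) (B k) (T j i) (R i k) (T j k))) \<and>
         (\<exists>P. space P = map A [1..<n + 1] \<and>
              (\<forall>i. 2 \<le> i \<and> i \<le> n \<longrightarrow>
                 (\<forall>Q. iterated_product K (n - 1) (merge_algebras K B R i) (merge_twists K B R i) Q
                       \<longleftrightarrow> Q = P)))"
proof -
  interpret tensor_products K
    by (rule tensor_products.intro) (rule assms)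
  have alg: "tensor_algebra (B i)" if "1 \<le> i" "i \<le> n" for i
    unfolding B_def by (rule talg_algebra) (use assms that in simp)
  have sys: "unital_system n B R"
    using assms(7,8) alg by (auto simp: unital_system_def twist_iff)
  have twisting: "twisting_map K (B i) (D j) (T j i)"
    if "2 \<le> j" "j \<le> n" "1 \<le> i" "i < j - 1" for i j
    unfolding D_def T_def
    using that by (intro twist_twisting_map alg merged_algebra_tensor_algebra[OF sys] merged_twist_right[OF sys]) auto
  have twisting': "twisting_map K (D j) (B i) (T j i)"
    if "2 \<le> j" "j \<le> n" "j < i" "i \<le> n" for i j
    unfolding D_def T_def
    using that by (intro twist_twisting_map alg merged_algebra_tensor_algebra[OF sys] merged_twist_left[OF sys]) auto
  have compat: "(k < j - 1 \<longrightarrow> compatible K (B i) (B k) (D j) (R i k) (T j k) (T j i)) \<and>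
      (i < j - 1 \<and> j < k \<longrightarrow> compatible K (B i) (D j) (B k) (T j i) (T j k) (R i k)) \<and>
      (j < i \<longrightarrow> compatible K (D j) (B i) (B k) (T j i) (R i k) (T j k))"
    if "2 \<le> j" "j \<le> n" "1 \<le> i" "i < k" "k \<le> n" for i j k
    unfolding D_def T_def
    using that merged_compatible_right[OF sys that(1,2)] merged_compatible_middle[OF sys that(1,2)]
      merged_compatible_left[OF sys that(1,2)]
    by simp
  obtain P where P: "space P = concat (map (\<lambda>i. space (B i)) [1..<n + 1])"
    "\<And>Q. iterated_product K n B R Q \<longleftrightarrow> Q = P"
    using iterated_product_unique[OF sys] assms(5) by auto
  have "space P = map A [1..<n + 1]"
    using P(1) by (simp add: B_def talg_def concat_map_singleton del: upt_Suc)
  moreover have "iterated_product K (n - 1) (merge_algebras K B R i) (merge_twists K B R i) Q \<longleftrightarrow> Q = P"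
    if i: "2 \<le> i" "i \<le> n" for i Q
  proof -
    \<comment> \<open>Any result after the first merge at \<open>i\<close> is a result for the whole
      list, hence equal to \<open>P\<close>. That such a result exists is the uniqueness lemma for
      the merged list of \<open>n - 1\<close> algebras.\<close>
    have to_P: "Q' = P" if "iterated_product K (n - 1) (merge_algebras K B R i) (merge_twists K B R i) Q'" for Q'
      using iterated_product.merge[OF assms(5) unital_system_twisting_system[OF sys] i that] P(2) by simp
    have "2 \<le> n - 1" using assms(5) by simp
    then obtain P' where "iterated_product K (n - 1) (merge_algebras K B R i) (merge_twists K B R i) P'"
      using iterated_product_unique[OF merge_unital_system[OF sys i]] by blast
    with to_P show ?thesis by auto
  qed
  ultimately show ?thesis
    using twisting twisting' compat by blast
qed

end
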